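(* Let $e,m\ge1$ be integers. The map $\Psi_{e,m}:\mathrm{Div}_e(\mathbb D)\to\mathrm{Div}_e(\mathbb D)$, $Z_f\mapsto R_f$, extends to a homeomorphism $$\Phi_{e,m}:\mathrm{Div}_e(\overline{\mathbb D})\to\mathrm{Div}_e(\overline{\mathbb D}).$$ The extension is given as follows: write $D\in\partial\,\mathrm{Div}_e(\mathbb D)$ as $D=D_1+D_2$, where $D_1\in\mathrm{Div}_{d_1}(\mathbb D)$, $D_2\in\mathrm{Div}_{d_2}(\partial\mathbb D)$ and $d_1+d_2=e$; then $$\Phi_{e,m}(D_1+D_2)=\Psi_{d_1,m}(D_1)+D_2.$$
   Context: An integral divisor of degree $e\ge0$ on $\Omega\subset\mathbb C$ is a finite formal sum $\sum\nu(q)\cdot q$, $q\in\Omega$, with integers $\nu(q)\ge0$ of total sum $e$. $\mathrm{Div}_e(\Omega)$ is the set of these, with the quotient topology from $\Omega^e$ via $(z_1,\dots,z_e)\mapsto\sum_k1\cdot z_k$. The boundary $\partial\,\mathrm{Div}_e(\mathbb D)$ is taken in $\mathrm{Div}_e(\overline{\mathbb D})$; it consists of the divisors $D_1+D_2$ with $D_1\in\mathrm{Div}_{d_1}(\mathbb D)$, $D_2\in\mathrm{Div}_{d_2}(\partial\mathbb D)$, $d_1+d_2=e$, $d_1\ge 0$, $d_2\ge1$. For integers $e\ge0,m\ge1$, $\mathcal B_{e,m}$ is the space of Blaschke products $f(z)=z^m\prod_{k=1}^e\Big(\frac{1-\overline{a_k}}{1-a_k}\cdot\frac{z-a_k}{1-\overline{a_k}z}\Big)$,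 $a_1,\dots,a_e\in\mathbb D$. The free zero divisor of $f$ is $Z_f=\sum_{k=1}^e1\cdot a_k\in\mathrm{Div}_e(\mathbb D)$; $f\mapsto Z_f$ is a bijection $\mathcal B_{e,m}\to\mathrm{Div}_e(\mathbb D)$. The ramification divisor of $f$ is $R(f)=\sum_{q\in\mathbb D}(\deg(f,q)-1)\cdot q$, where $\deg(f,q)$ is the multiplicity of $q$ as a zero of $f(z)-f(q)$, and the free ramification divisor $R_f\in\mathrm{Div}_e(\mathbb D)$ is defined by $R(f)=(m-1)\cdot0+R_f$. By a theorem of Heins and Zakeri, $\Psi_{e,m}:Z_f\mapsto R_f$ is a homeomorphism of $\mathrm{Div}_e(\mathbb D)$ for all $e\ge1$. For $e=0$, $\mathrm{Div}_0(\mathbb D)$ consists of the zero divisor only and $\Psi_{0,m}$ is the trivial map. *)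

theory Defs
  imports "HOL-Complex_Analysis.Complex_Analysis" "HOL-Library.Multiset"
begin

section \<open>Integral divisors\<close>

text \<open>An integral divisor is a finite multiset of points, the multiplicity \<open>\<nu>(q)\<close> being
  \<open>count D q\<close>; the degree is the size and addition is multiset sum.\<close>

definition Div :: "nat \<Rightarrow> complex set \<Rightarrow> complex multiset set" where
  "Div e \<Omega> = {D. set_mset D \<subseteq> \<Omega> \<and> size D = e}"

text \<open>Points of \<open>\<Omega>\<^sup>e\<close> are functions on the index set \<open>{..<e}\<close>
  (extensional, when viewed as points of the product space).\<close>

definition tuple_divisor :: "nat \<Rightarrow> (nat \<Rightarrow> complex) \<Rightarrow> complex multiset" where
  "tuple_divisor e z = (\<Sum>k<e. {#z k#})"

definition power_topology :: "nat \<Rightarrow> complex set \<Rightarrow> (nat \<Rightarrow> complex) topology" where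
  "power_topology e \<Omega> = product_topology (\<lambda>_. top_of_set \<Omega>) {..<e}"

definition Div_topology :: "nat \<Rightarrow> complex set \<Rightarrow> complex multiset topology" where
  "Div_topology e \<Omega> = topology (\<lambda>U. U \<subseteq> Div e \<Omega> \<and>
     openin (power_topology e \<Omega>) {z \<in> topspace (power_topology e \<Omega>). tuple_divisor e z \<in> U})"

lemma topspace_power_topology: "topspace (power_topology e \<Omega>) = {..<e} \<rightarrow>\<^sub>E \<Omega>"
  by (simp add: power_topology_def)

lemma openin_Div_topology:
  "openin (Div_topology e \<Omega>) U \<longleftrightarrow> U \<subseteq> Div e \<Omega> \<and>
     openin (power_topology e \<Omega>) {z \<in> topspace (power_topology e \<Omega>). tuple_divisor e z \<in> U}"
proof -
  let ?P = "power_topology e \<Omega>"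
  let ?pre = "\<lambda>U. {z \<in> topspace ?P. tuple_divisor e z \<in> U}"
  have "istopology (\<lambda>U. U \<subseteq> Div e \<Omega> \<and> openin ?P (?pre U))"
    unfolding istopology_def
  proof (intro conjI allI impI)
    fix S T assume S: "S \<subseteq> Div e \<Omega> \<and> openin ?P (?pre S)" and T: "T \<subseteq> Div e \<Omega> \<and> openin ?P (?pre T)"
    have "?pre (S \<inter> T) = ?pre S \<inter> ?pre T" by auto
    then show "openin ?P (?pre (S \<inter> T))" using S T by (simp add: openin_Int)
    show "S \<inter> T \<subseteq> Div e \<Omega>" using S by auto
  next
    fix \<K> assume K: "\<forall>K\<in>\<K>. K \<subseteq> Div e \<Omega> \<and> openin ?P (?pre K)"
    have "?pre (\<Union>\<K>) = \<Union>(?pre ` \<K>)" by auto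
    moreover have "openin ?P (\<Union>(?pre ` \<K>))" using K by (intro openin_Union) auto
    ultimately show "openin ?P (?pre (\<Union>\<K>))" by simp
    show "\<Union>\<K> \<subseteq> Div e \<Omega>" using K by auto
  qed
  then show ?thesis
    unfolding Div_topology_def by simp
qed

lemma tuple_divisor_image:
  "tuple_divisor e z = image_mset z (mset_set {..<e})"
  unfolding tuple_divisor_def
  by (induction e) (auto simp: lessThan_Suc)

lemma tuple_divisor_mset: "tuple_divisor e z = mset (map z [0..<e])"
  unfolding tuple_divisor_image
  by (metis mset_map mset_set_set mset_upt atLeast0LessThan)

lemma tuple_divisor_in_Div: "tuple_divisor e z \<in> Div e \<Omega> \<longleftrightarrow> (\<forall>k<e. z k \<in> \<Omega>)"
  unfolding tuple_divisor_mset Div_def by auto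

lemma Div_tupleE:
  assumes "D \<in> Div e \<Omega>"
  obtains z where "z \<in> {..<e} \<rightarrow>\<^sub>E \<Omega>" "tuple_divisor e z = D"
proof -
  obtain xs where xs: "mset xs = D" using ex_mset by blast
  then have len: "length xs = e" using assms by (auto simp: Div_def)
  have sub: "set xs \<subseteq> \<Omega>" using assms xs by (auto simp: Div_def)
  let ?z = "restrict (\<lambda>k. xs ! k) {..<e}"
  have "map ?z [0..<e] = xs"
    using len by (intro nth_equalityI) auto
  then have "tuple_divisor e ?z = D" using xs by (simp add: tuple_divisor_mset)
  moreover have "?z \<in> {..<e} \<rightarrow>\<^sub>E \<Omega>" using len sub by auto
  ultimately show ?thesis using that by blast
qed

lemma tuple_divisor_image_PiE: "tuple_divisor e ` ({..<e} \<rightarrow>\<^sub>E \<Omega>) = Div e \<Omega>"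
proof (intro equalityI subsetI)
  fix D assume "D \<in> tuple_divisor e ` ({..<e} \<rightarrow>\<^sub>E \<Omega>)"
  then obtain z where "z \<in> {..<e} \<rightarrow>\<^sub>E \<Omega>" "D = tuple_divisor e z" by blast
  then show "D \<in> Div e \<Omega>" by (simp add: tuple_divisor_in_Div PiE_iff)
next
  fix D assume "D \<in> Div e \<Omega>"
  then obtain z where "z \<in> {..<e} \<rightarrow>\<^sub>E \<Omega>" "tuple_divisor e z = D" by (rule Div_tupleE)
  then show "D \<in> tuple_divisor e ` ({..<e} \<rightarrow>\<^sub>E \<Omega>)" by blast
qed

lemma topspace_Div_topology: "topspace (Div_topology e \<Omega>) = Div e \<Omega>"
proof -
  have "{z \<in> topspace (power_topology e \<Omega>). tuple_divisor e z \<in> Div e \<Omega>} = topspace (power_topology e \<Omega>)"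
    by (auto simp: topspace_power_topology tuple_divisor_in_Div)
  then have "openin (Div_topology e \<Omega>) (Div e \<Omega>)"
    by (simp add: openin_Div_topology)
  then show ?thesis
    by (meson openin_Div_topology openin_subset openin_topspace subset_antisym)
qed

lemma quotient_map_tuple_divisor:
  "quotient_map (power_topology e \<Omega>) (Div_topology e \<Omega>) (tuple_divisor e)"
  unfolding quotient_map_def topspace_Div_topology openin_Div_topology
  by (simp add: topspace_power_topology tuple_divisor_image_PiE)

lemma Div_frontier:
  "Div_topology e (cball 0 1) frontier_of Div e (ball 0 1) =
     {D1 + D2 | D1 D2 d1 d2. d1 + d2 = e \<and> d2 \<ge> 1 \<and> D1 \<in> Div d1 (ball 0 1) \<and> D2 \<in> Div d2 (sphere 0 1)}"
proof -
  let ?T = "Div_topology e (cball 0 1)" and ?P = "power_topology e (cball (0::complex) 1)"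
  have "{z \<in> topspace ?P. tuple_divisor e z \<in> Div e (ball 0 1)} = {..<e} \<rightarrow>\<^sub>E ball 0 1"
    using ball_subset_cball[of "0::complex" 1]
    by (simp only: topspace_power_topology tuple_divisor_in_Div PiE_iff set_eq_iff mem_Collect_eq lessThan_iff) blast
  moreover have "openin ?P ({..<e} \<rightarrow>\<^sub>E ball (0::complex) 1)"
    unfolding power_topology_def
    by (subst openin_PiE) (simp_all add: ball_subset_cball open_subset)
  moreover have "Div e (ball 0 1) \<subseteq> Div e (cball (0::complex) 1)"
    using ball_subset_cball[of "0::complex" 1] unfolding Div_def by blast
  ultimately have opn: "openin ?T (Div e (ball 0 1))"
    by (simp add: openin_Div_topology)
  have cl: "?T closure_of (Div e (ball 0 1)) = Div e (cball 0 1)"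
  proof (intro equalityI subsetI)
    fix D assume "D \<in> ?T closure_of (Div e (ball 0 1))"
    then show "D \<in> Div e (cball 0 1)"
      by (metis in_closure_of topspace_Div_topology)
  next
    fix D :: "complex multiset" assume D: "D \<in> Div e (cball 0 1)"
    then obtain z where z: "z \<in> {..<e} \<rightarrow>\<^sub>E cball 0 1" "tuple_divisor e z = D"
      by (rule Div_tupleE)
    define g where "g = (\<lambda>r::real. \<lambda>k\<in>{..<e}. of_real r * z k)"
    have gc: "continuous_map (top_of_set {0..1}) ?P g"
      unfolding power_topology_def g_def
    proof (intro continuous_map_coordinatewise_then_product)
      fix k assume k: "k \<in> {..<e}"
      then have zk: "norm (z k) \<le> 1" using z by (auto simp: PiE_iff)
      have "norm (of_real r * z k) \<le> 1" if "r \<in> {0..1}" for r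
        using that zk by (auto simp: norm_mult intro!: mult_le_one)
      then show "continuous_map (top_of_set {0..1}) (top_of_set (cball 0 1))
             (\<lambda>r. (\<lambda>k\<in>{..<e}. of_real r * z k) k)"
        using k by (auto intro!: continuous_intros)
    qed auto
    have g1: "g 1 = z" using z(1) unfolding g_def by (auto simp: PiE_iff extensional_def)
    show "D \<in> ?T closure_of (Div e (ball 0 1))"
      unfolding in_closure_of topspace_Div_topology
    proof (intro conjI allI impI D)
      fix U assume U: "D \<in> U \<and> openin ?T U"
      let ?V = "{z \<in> topspace ?P. tuple_divisor e z \<in> U}"
      have "openin (top_of_set {0..1}) {r \<in> {0..1}. g r \<in> ?V}"
        using openin_continuous_map_preimage[OF gc, of ?V] U by (simp add: openin_Div_topology)
      then obtain W where W: "open W" "{r \<in> {0..1}. g r \<in> ?V} = {0..1} \<inter> W"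
        by (auto simp: openin_open)
      have "1 \<in> W"
        using W(2) U z g1 by (auto simp: topspace_power_topology)
      then obtain \<epsilon> where \<epsilon>: "\<epsilon> > 0" "ball 1 \<epsilon> \<subseteq> W" using W(1) openE by blast
      define r where "r = max (1/2) (1 - \<epsilon>/2)"
      have r: "0 \<le> r" "r < 1" "r \<in> ball 1 \<epsilon>"
        using \<epsilon>(1) by (auto simp: r_def dist_real_def max_def)
      then have "r \<in> {0..1} \<inter> W" using \<epsilon>(2) by auto
      then have "g r \<in> ?V" unfolding W(2)[symmetric] by blast
      moreover have "tuple_divisor e (g r) \<in> Div e (ball 0 1)"
        unfolding tuple_divisor_in_Div
      proof (intro allI impI)
        fix k assume k: "k < e"
        then have "norm (z k) \<le> 1" using z by (auto simp: PiE_iff)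
        then have "r * norm (z k) \<le> r" using r by (simp add: mult_left_le)
        then show "g r k \<in> ball 0 1" using k r by (simp add: g_def norm_mult)
      qed
      ultimately show "\<exists>y. y \<in> Div e (ball 0 1) \<and> y \<in> U" by blast
    qed
  qed
  have "Div_topology e (cball 0 1) frontier_of Div e (ball 0 1) = Div e (cball 0 1) - Div e (ball 0 1)"
    unfolding frontier_of_def cl using opn by (simp add: interior_of_openin)
  also have "\<dots> = {D1 + D2 | D1 D2 d1 d2. d1 + d2 = e \<and> d2 \<ge> 1 \<and> D1 \<in> Div d1 (ball 0 1) \<and> D2 \<in> Div d2 (sphere 0 1)}"
    (is "_ = ?R")
  proof (intro equalityI subsetI)
    fix D assume D: "D \<in> Div e (cball 0 1) - Div e (ball (0::complex) 1)"
    define A where "A = filter_mset (\<lambda>q. q \<in> ball 0 1) D"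
    define B where "B = filter_mset (\<lambda>q. q \<notin> ball 0 1) D"
    have DAB: "D = A + B" unfolding A_def B_def by (rule multiset_partition)
    have D': "set_mset D \<subseteq> cball 0 1" "size D = e" "\<not> set_mset D \<subseteq> ball 0 1"
      using D by (simp_all only: Div_def) auto
    then obtain q where "q \<in># D" "q \<notin> ball 0 1" by blast
    then have "q \<in># B" by (simp add: B_def)
    then have "size B > 0" by (metis empty_iff set_mset_empty nonempty_has_size)
    moreover have "size A + size B = e"
      using D'(2) size_union[of A B] unfolding DAB[symmetric] by simp
    moreover have "A \<in> Div (size A) (ball 0 1)" "B \<in> Div (size B) (sphere 0 1)"
      using D'(1) unfolding Div_def A_def B_def by (auto simp: subset_iff le_less)
    ultimately show "D \<in> ?R" using DAB by (auto simp: Suc_le_eq)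
  next
    fix D assume "D \<in> ?R"
    then obtain D1 D2 d1 d2 where *: "D = D1 + D2" "d1 + d2 = e" "d2 \<ge> 1"
      "D1 \<in> Div d1 (ball 0 1)" "D2 \<in> Div d2 (sphere 0 1)" by blast
    have "D2 \<noteq> {#}" using * by (auto simp: Div_def)
    then obtain q where "q \<in># D2" by blast
    with * have "q \<in># D" "q \<notin> ball 0 1" by (auto simp: Div_def)
    then have "D \<notin> Div e (ball 0 1)" unfolding Div_def by blast
    moreover have "set_mset D1 \<subseteq> cball 0 1" "set_mset D2 \<subseteq> cball 0 1" "size D = e"
      using * ball_subset_cball[of "0::complex" 1] sphere_cball[of "0::complex" 1]
      unfolding Div_def by (blast, blast, simp)
    then have "D \<in> Div e (cball 0 1)" by (simp add: Div_def *(1))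
    ultimately show "D \<in> Div e (cball 0 1) - Div e (ball 0 1)" by blast
  qed
  finally show ?thesis .
qed


section \<open>Blaschke products\<close>

text \<open>Blaschke products are represented as total functions; off the poles they have their usual
  values, and only their values in the unit disk matter below.\<close>

definition blaschke :: "nat \<Rightarrow> nat \<Rightarrow> (nat \<Rightarrow> complex) \<Rightarrow> complex \<Rightarrow> complex" where
  "blaschke e m a z =
     z ^ m * (\<Prod>k<e. (1 - cnj (a k)) / (1 - a k) * ((z - a k) / (1 - cnj (a k) * z)))"

definition blaschke_space :: "nat \<Rightarrow> nat \<Rightarrow> (complex \<Rightarrow> complex) set" where
  "blaschke_space e m = {blaschke e m a | a. \<forall>k<e. a k \<in> ball 0 1}"

text \<open>The free zero divisor \<open>Z\<^sub>f\<close>; it is well defined by \<open>free_zeros_blaschke\<close> below.\<close>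

definition free_zeros :: "nat \<Rightarrow> nat \<Rightarrow> (complex \<Rightarrow> complex) \<Rightarrow> complex multiset" where
  "free_zeros e m f =
     (THE Z. \<exists>a. (\<forall>k<e. a k \<in> ball 0 1) \<and> f = blaschke e m a \<and> Z = tuple_divisor e a)"

text \<open>The multiplicity of \<open>q\<close> as a zero of \<open>f(z) - f(q)\<close>, for \<open>f\<close> holomorphic and nonconstant near \<open>q\<close>.\<close>

definition local_degree :: "(complex \<Rightarrow> complex) \<Rightarrow> complex \<Rightarrow> nat" where
  "local_degree f q = nat (zorder (\<lambda>z. f z - f q) q)"

text \<open>The divisor \<open>R(f)\<close>. The restriction to points of local degree greater than \<open>1\<close> drops only zero
  summands and makes the index set finite for a nonconstant \<open>f\<close> in \<open>blaschke_space e m\<close>.\<close>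

definition ramification_divisor :: "(complex \<Rightarrow> complex) \<Rightarrow> complex multiset" where
  "ramification_divisor f =
     (\<Sum>q | q \<in> ball 0 1 \<and> local_degree f q > 1. replicate_mset (local_degree f q - 1) q)"

text \<open>\<open>R\<^sub>f\<close>, determined by \<open>R(f) = (m - 1) \<cdot> 0 + R\<^sub>f\<close>. The multiset difference does not truncate for
  \<open>f\<close> in \<open>blaschke_space e m\<close>, as such \<open>f\<close> vanishes at \<open>0\<close> to order at least \<open>m\<close>.\<close>

definition free_ramification :: "nat \<Rightarrow> (complex \<Rightarrow> complex) \<Rightarrow> complex multiset" where
  "free_ramification m f = ramification_divisor f - replicate_mset (m - 1) 0"

text \<open>The map \<open>Z\<^sub>f \<mapsto> R\<^sub>f\<close>; see \<open>bij_betw_free_zeros\<close> and \<open>Psi_free_zeros\<close>.\<close>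

definition Psi :: "nat \<Rightarrow> nat \<Rightarrow> complex multiset \<Rightarrow> complex multiset" where
  "Psi e m D = free_ramification m (the_inv_into (blaschke_space e m) (free_zeros e m) D)"

lemma order_prod_linear:
  "order (q::complex) (\<Prod>k<e. [:- a k, 1:]) = count (tuple_divisor e a) q"
proof (induction e)
  case (Suc e)
  have "(\<Prod>k<e. [:- a k, 1:]) * [:- a e, 1:] \<noteq> 0"
    by (simp add: prod_zero_iff del: mult_pCons_right mult_pCons_left)
  moreover have "order q [:- a e, 1:] = (if a e = q then 1 else 0)"
    using order_power_n_n[of "a e" 1] by (auto intro: order_0I)
  ultimately show ?case
    using Suc by (simp add: order_mult tuple_divisor_def lessThan_Suc add.commute del: mult_pCons_right mult_pCons_left)
qed (simp add: tuple_divisor_def)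

lemma tuple_divisor_eq_if_blaschke_eq:
  assumes a: "\<forall>k<e. a k \<in> ball 0 1" and b: "\<forall>k<e. b k \<in> ball 0 1"
    and eq: "blaschke e m a = blaschke e m b"
  shows "tuple_divisor e a = tuple_divisor e b"
proof -
  define p where "p = (\<lambda>a::nat \<Rightarrow> complex. \<Prod>k<e. [:- a k, 1:])"
  define r where "r = (\<lambda>a::nat \<Rightarrow> complex. \<Prod>k<e. [:1, - cnj (a k):])"
  define c where "c = (\<lambda>a::nat \<Rightarrow> complex. \<Prod>k<e. (1 - cnj (a k)) / (1 - a k))"
  have p0: "p a \<noteq> 0" for a by (auto simp: p_def prod_zero_iff)
  have r0: "poly (r a) z \<noteq> 0" if "\<forall>k<e. a k \<in> ball 0 1" "z \<in> ball 0 1" for a z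
  proof -
    have "1 - z * cnj (a k) \<noteq> 0" if k: "k < e" for k
    proof
      assume "1 - z * cnj (a k) = 0"
      then have "norm (z * cnj (a k)) = 1" by (metis eq_iff_diff_eq_0 norm_one)
      moreover have "norm z * norm (a k) < 1 * 1"
        using that k \<open>\<forall>k<e. a k \<in> ball 0 1\<close> \<open>z \<in> ball 0 1\<close> by (intro mult_strict_mono') auto
      ultimately show False by (simp add: norm_mult)
    qed
    then show ?thesis by (auto simp: r_def poly_prod)
  qed
  have c0: "c a \<noteq> 0" if "\<forall>k<e. a k \<in> ball 0 1" for a
  proof -
    have "a k \<noteq> 1" "cnj (a k) \<noteq> 1" if "k < e" for k
      using \<open>\<forall>k<e. a k \<in> ball 0 1\<close> that by (auto simp: complex_cnj_one_iff)
    then show ?thesis by (auto simp: c_def)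
  qed
  have bl: "blaschke e m a z = z ^ m * (c a * (poly (p a) z / poly (r a) z))" for a z
    by (simp add: blaschke_def p_def r_def c_def poly_prod prod.distrib prod_dividef mult.commute)
  have key: "smult (c a) (p a * r b) = smult (c b) (p b * r a)" (is "?l = ?r")
  proof (rule ccontr)
    assume "?l \<noteq> ?r"
    then have fin: "finite {z. poly (?l - ?r) z = 0}" by (intro poly_roots_finite) simp
    have "ball 0 1 - {0} \<subseteq> {z. poly (?l - ?r) z = 0}"
    proof
      fix z :: complex assume z: "z \<in> ball 0 1 - {0}"
      have "z ^ m * (c a * (poly (p a) z / poly (r a) z)) = z ^ m * (c b * (poly (p b) z / poly (r b) z))"
        using fun_cong[OF eq, of z] by (simp only: bl)
      then have "c a * (poly (p a) z / poly (r a) z) = c b * (poly (p b) z / poly (r b) z)"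
        by (rule mult_left_cancel[THEN iffD1, rotated]) (use z in simp)
      then show "z \<in> {z. poly (?l - ?r) z = 0}"
        using r0[OF a, of z] r0[OF b, of z] z by (simp add: field_simps)
    qed
    then have "finite (ball (0::complex) 1 - {0})" using fin finite_subset by blast
    then have "finite (ball (0::complex) 1)" by simp
    then show False using uncountable_ball[of 1 "0::complex"] countable_finite by auto
  qed
  show ?thesis
  proof (rule multiset_eqI)
    fix q
    show "count (tuple_divisor e a) q = count (tuple_divisor e b) q"
    proof (cases "q \<in> ball 0 1")
      case True
      have rn: "r a \<noteq> 0" "r b \<noteq> 0" using r0[OF a True] r0[OF b True] by auto
      have "order q (r a) = 0" "order q (r b) = 0"
        using r0[OF a True] r0[OF b True] by (auto intro: order_0I)
      then have "order q (p a) = order q (p b)"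
        using arg_cong[OF key, of "order q"] p0[of a] p0[of b] rn c0[OF a] c0[OF b]
        by (simp add: order_smult order_mult)
      then show ?thesis by (simp add: p_def order_prod_linear)
    next
      case False
      have "tuple_divisor e a \<in> Div e (ball 0 1)" "tuple_divisor e b \<in> Div e (ball 0 1)"
        using a b by (auto simp: tuple_divisor_in_Div)
      then show ?thesis using False
        by (metis (no_types, lifting) Div_def mem_Collect_eq not_in_iff subsetD)
    qed
  qed
qed

lemma free_zeros_blaschke:
  assumes "\<forall>k<e. a k \<in> ball 0 1"
  shows "free_zeros e m (blaschke e m a) = tuple_divisor e a"
  unfolding free_zeros_def
proof (rule the_equality)
  show "\<exists>b. (\<forall>k<e. b k \<in> ball 0 1) \<and> blaschke e m a = blaschke e m b \<and> tuple_divisor e a = tuple_divisor e b"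
    using assms by blast
  show "Z = tuple_divisor e a"
    if "\<exists>b. (\<forall>k<e. b k \<in> ball 0 1) \<and> blaschke e m a = blaschke e m b \<and> Z = tuple_divisor e b" for Z
  proof -
    from that obtain b where b: "\<forall>k<e. b k \<in> ball 0 1" "blaschke e m a = blaschke e m b"
      "Z = tuple_divisor e b" by blast
    show ?thesis using tuple_divisor_eq_if_blaschke_eq[OF assms b(1,2)] b(3) by simp
  qed
qed

lemma blaschke_cong_tuple_divisor:
  assumes "tuple_divisor e a = tuple_divisor e b"
  shows "blaschke e m a = blaschke e m b"
proof
  fix z
  have "blaschke e m a z = z ^ m *
      (\<Prod>x\<in>#tuple_divisor e a. (1 - cnj x) / (1 - x) * ((z - x) / (1 - cnj x * z)))" for a
    by (simp add: blaschke_def tuple_divisor_image prod_unfold_prod_mset multiset.map_comp o_def)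
  then show "blaschke e m a z = blaschke e m b z" using assms by simp
qed

lemma bij_betw_free_zeros:
  "bij_betw (free_zeros e m) (blaschke_space e m) (Div e (ball 0 1))"
  unfolding bij_betw_def
proof
  show "inj_on (free_zeros e m) (blaschke_space e m)"
    by (intro inj_onI) (force simp: blaschke_space_def free_zeros_blaschke intro: blaschke_cong_tuple_divisor)
  show "free_zeros e m ` blaschke_space e m = Div e (ball 0 1)"
  proof (intro equalityI subsetI)
    fix D assume "D \<in> Div e (ball (0::complex) 1)"
    then obtain a where a: "a \<in> {..<e} \<rightarrow>\<^sub>E ball 0 1" "tuple_divisor e a = D" by (rule Div_tupleE)
    then have a': "\<forall>k<e. a k \<in> ball 0 1" by (auto simp: PiE_iff)
    then show "D \<in> free_zeros e m ` blaschke_space e m"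
      using a free_zeros_blaschke[OF a', of m] by (force simp: blaschke_space_def)
  next
    fix D assume "D \<in> free_zeros e m ` blaschke_space e m"
    then obtain a where "\<forall>k<e. a k \<in> ball 0 1" "D = free_zeros e m (blaschke e m a)"
      unfolding blaschke_space_def by blast
    then show "D \<in> Div e (ball 0 1)"
      by (simp add: free_zeros_blaschke tuple_divisor_in_Div)
  qed
qed

lemma Psi_free_zeros:
  "f \<in> blaschke_space e m \<Longrightarrow> Psi e m (free_zeros e m f) = free_ramification m f"
  unfolding Psi_def
  using the_inv_into_f_f[OF bij_betw_imp_inj_on[OF bij_betw_free_zeros]] by metis

end

theory Submission
  imports Defs "HOL-Homology.Invariance_of_Domain" "HOL-Computational_Algebra.Fundamental_Theorem_Algebra"
begin

hide_const (open) Module.smult Coset.order up_ring.coeff up_ring.monom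

text \<open>
  Write \<open>f = c z\<^sup>m P / Q\<close> with \<open>P = \<Prod>(z - a\<^sub>k)\<close>, \<open>Q = \<Prod>(1 - cnj a\<^sub>k z)\<close>. The free critical points of \<open>f\<close> are
  the zeros in the disk of \<open>F = m P Q + z (P' Q - P Q')\<close>. This polynomial is self-reciprocal of formal
  degree \<open>2 e\<close> without zeros on the circle, so it is a multiple of \<open>\<Prod>(z - c\<^sub>k)(1 - cnj c\<^sub>k z)\<close> with
  \<open>R\<^sub>f = \<Sum>c\<^sub>k\<close>. Since \<open>F\<close> also makes sense for zeros on the circle, where each \<open>a\<^sub>k\<close> just
  contributes the factor \<open>(z - a\<^sub>k)(1 - cnj a\<^sub>k z)\<close>, proportionality of \<open>F\<close> and
  \<open>\<Prod>(z - c\<^sub>k)(1 - cnj c\<^sub>k z)\<close> is a closed relation on compact spaces whose graph is the extended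
  map; hence that map is continuous.

  Injectivity is the uniqueness theorem of Heins: if \<open>f\<close> and \<open>g\<close> have the same critical points, the
  quotient of the pulled back hyperbolic densities \<open>|f'| / (1 - |f|\<^sup>2)\<close> and \<open>|g'| / (1 - |g|\<^sup>2)\<close> extends
  continuously by 1 to the circle and has no interior maximum above 1, so it is constantly 1, and
  polarization recovers \<open>Q\<close>. Surjectivity follows from invariance of domain in the coefficients of
  \<open>P\<close>, since the open disk part of the divisor space is connected and its image is relatively closed.
\<close>

section \<open>Zero, pole and critical polynomials\<close>

definition zero_poly :: "complex multiset \<Rightarrow> complex poly" where
  "zero_poly D = (\<Prod>x\<in>#D. [:- x, 1:])"

definition pole_poly :: "complex multiset \<Rightarrow> complex poly" where
  "pole_poly D = (\<Prod>x\<in>#D. [:1, - cnj x:])"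

text \<open>The numerator of the derivative of \<open>z ^ m * P / Q\<close> over
  \<open>Q\<^sup>2\<close>, with \<open>z ^ (m - 1)\<close> split off. As a polynomial it keeps its
  meaning when points of \<open>D\<close> reach the circle, where \<open>P\<close> and
  \<open>Q\<close> acquire common roots.\<close>

definition crit_poly :: "nat \<Rightarrow> complex multiset \<Rightarrow> complex poly" where
  "crit_poly m D = smult (of_nat m) (zero_poly D * pole_poly D)
     + [:0, 1:] * (pderiv (zero_poly D) * pole_poly D - zero_poly D * pderiv (pole_poly D))"

lemma zero_poly_empty [simp]: "zero_poly {#} = 1"
  and zero_poly_add_mset: "zero_poly (add_mset x D) = [:- x, 1:] * zero_poly D"
  and zero_poly_union: "zero_poly (D + D') = zero_poly D * zero_poly D'"
  by (simp_all add: zero_poly_def)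

lemma pole_poly_empty [simp]: "pole_poly {#} = 1"
  and pole_poly_add_mset: "pole_poly (add_mset x D) = [:1, - cnj x:] * pole_poly D"
  and pole_poly_union: "pole_poly (D + D') = pole_poly D * pole_poly D'"
  by (simp_all add: pole_poly_def)

lemma crit_poly_empty [simp]: "crit_poly m {#} = [:of_nat m:]"
  by (simp add: crit_poly_def one_pCons)

text \<open>Product rule. The last summand arises from
  \<open>[:1, - cnj x:] + [:- x, 1:] * [:cnj x:]\<close>, which is the constant
  \<open>1 - x * cnj x\<close>. This recursion drives the later inductions on the divisor.\<close>

lemma crit_poly_add_mset:
  "crit_poly m (add_mset x D) = [:- x, 1:] * [:1, - cnj x:] * crit_poly m D
     + smult (1 - x * cnj x) ([:0, 1:] * (zero_poly D * pole_poly D))"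
proof -
  define p q where "p = zero_poly D" and "q = pole_poly D"
  have 1: "pderiv ([:- x, 1:] * p) = p + [:- x, 1:] * pderiv p"
    by (subst pderiv_mult) (simp add: pderiv_pCons algebra_simps)
  have 2: "pderiv ([:1, - cnj x:] * q) = [:1, - cnj x:] * pderiv q - smult (cnj x) q"
    by (subst pderiv_mult) (simp add: pderiv_pCons algebra_simps)
  have 3: "smult c r = [:c:] * r" for c :: complex and r by simp
  have 4: "[:1 - x * cnj x:] = [:1, - cnj x:] + [:- x, 1:] * [:cnj x:]"
    by simp
  show ?thesis
    unfolding crit_poly_def zero_poly_add_mset pole_poly_add_mset p_def[symmetric] q_def[symmetric] 1 2
    unfolding 3 4
    by (simp only: algebra_simps)
qed

section \<open>Reflection in the unit circle and orders of roots\<close>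

lemma zero_poly_nonzero [simp]: "zero_poly D \<noteq> 0"
  by (auto simp: zero_poly_def prod_mset_zero_iff)

lemma pole_poly_nonzero [simp]: "pole_poly D \<noteq> 0"
  by (auto simp: pole_poly_def prod_mset_zero_iff)

lemma poly_zero_poly: "poly (zero_poly D) z = (\<Prod>x\<in>#D. z - x)"
  by (induction D) (simp_all add: zero_poly_add_mset del: mult_pCons_left)

lemma poly_pole_poly: "poly (pole_poly D) z = (\<Prod>x\<in>#D. 1 - cnj x * z)"
  by (induction D) (simp_all add: pole_poly_add_mset algebra_simps)

text \<open>Factor by factor, \<open>z * cnj (1 / cnj z - x) = 1 - cnj x * z\<close>. The exponent
  is the size of the divisor, which exceeds the degree of \<open>pole_poly D\<close> when 0 occurs
  in \<open>D\<close>.\<close>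

lemma poly_pole_poly_reflect:
  assumes "z \<noteq> 0"
  shows "z ^ size D * cnj (poly (zero_poly D) (1 / cnj z)) = poly (pole_poly D) z"
  using assms by (induction D) (simp_all add: poly_zero_poly poly_pole_poly field_simps)

lemma poly_zero_poly_reflect:
  assumes "z \<noteq> 0"
  shows "z ^ size D * cnj (poly (pole_poly D) (1 / cnj z)) = poly (zero_poly D) z"
  using assms by (induction D) (simp_all add: poly_zero_poly poly_pole_poly field_simps)

lemma one_minus_cnj_mult_nonzero:
  assumes "norm x < 1" "norm z \<le> 1"
  shows "1 - cnj x * z \<noteq> 0"
proof
  assume "1 - cnj x * z = 0"
  then have "norm (cnj x * z) = 1" by (metis eq_iff_diff_eq_0 norm_one)
  moreover have "norm x * norm z \<le> norm x * 1" using assms by (intro mult_left_mono) auto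
  ultimately show False using assms by (simp add: norm_mult)
qed

lemma poly_pole_poly_nonzero:
  assumes "set_mset D \<subseteq> ball 0 1" "norm z \<le> 1"
  shows "poly (pole_poly D) z \<noteq> 0"
  using assms one_minus_cnj_mult_nonzero by (fastforce simp: poly_pole_poly prod_mset_zero_iff)

lemma order_zero_poly: "order q (zero_poly D) = count D q"
proof (induction D)
  case (add x D)
  have "[:- x, 1:] * zero_poly D \<noteq> 0" by (metis mult_eq_0_iff one_neq_zero pCons_eq_0_iff zero_poly_nonzero)
  moreover have "order q [:- x, 1:] = (if x = q then 1 else 0)"
    using order_power_n_n[of x 1] by (auto intro: order_0I)
  ultimately show ?case
    using add by (simp add: zero_poly_add_mset order_mult del: mult_pCons_left)
qed (simp add: order_1_eq_0)

lemma zero_poly_inj: "zero_poly D = zero_poly D' \<Longrightarrow> D = D'"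
  by (metis multiset_eqI order_zero_poly)

lemma order_pole_poly_ball:
  assumes "set_mset D \<subseteq> cball 0 1" "norm q < 1"
  shows "order q (pole_poly D) = 0"
proof (rule order_0I)
  \<comment> \<open>Here \<open>q\<close> is the point of norm below 1, since \<open>x\<close> may
    lie on the circle; conjugation exchanges the two roles.\<close>
  have "1 - cnj x * q \<noteq> 0" if "x \<in># D" for x
    using one_minus_cnj_mult_nonzero[of q x] that assms by (auto simp: mult.commute complex_eq_iff)
  then show "poly (pole_poly D) q \<noteq> 0"
    by (auto simp: poly_pole_poly prod_mset_zero_iff)
qed

text \<open>For \<open>x\<close> on the circle, \<open>1 - cnj x * z\<close> is
  \<open>- cnj x * (z - x)\<close>, so such a point is a root of the zero polynomial and of the pole
  polynomial alike.\<close>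

lemma order_pole_poly_sphere:
  assumes "norm q = 1"
  shows "order q (pole_poly D) = count D q"
proof (induction D)
  case (add x D)
  have 0: "[:1, - cnj x:] * pole_poly D \<noteq> 0" by (metis mult_eq_0_iff one_neq_zero pCons_eq_0_iff pole_poly_nonzero)
  have q: "q * cnj q = 1" using assms by (simp add: complex_norm_square[symmetric])
  have "order q [:1, - cnj x:] = (if x = q then 1 else 0)"
  proof (cases "x = q")
    case True
    have "[:1, - cnj q:] = smult (- cnj q) [:- q, 1:]" using q by (simp add: mult.commute)
    moreover have "cnj q \<noteq> 0" using assms by auto
    ultimately show ?thesis using order_power_n_n[of q 1] True by (simp add: order_smult del: smult_pCons)
  next
    case False
    have "1 - q * cnj x \<noteq> 0"
    proof
      assume "1 - q * cnj x = 0"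
      then have "cnj q * (q * cnj x) = cnj q" by simp
      then have "cnj x = cnj q" using q by (simp add: mult.assoc[symmetric] mult.commute[of "cnj q"])
      then show False using False by simp
    qed
    then show ?thesis using False by (auto intro: order_0I)
  qed
  then show ?case
    using add 0 by (simp add: pole_poly_add_mset order_mult del: mult_pCons_left)
qed (simp add: order_1_eq_0)

text \<open>Compare orders of roots. Inside the disk only the zero polynomial contributes; on the
  circle both factors contribute equally, so the order is twice the multiplicity and still
  determines it.\<close>

lemma proportional_imp_eq:
  assumes "set_mset C \<subseteq> cball 0 1" "set_mset C' \<subseteq> cball 0 1" "c \<noteq> 0"
    and eq: "zero_poly C * pole_poly C = smult c (zero_poly C' * pole_poly C')"
  shows "C = C'"
proof (rule multiset_eqI)
  fix q
  have o: "count C q + order q (pole_poly C) = count C' q + order q (pole_poly C')"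
    using arg_cong[OF eq, of "order q"] \<open>c \<noteq> 0\<close> by (simp add: order_smult order_mult order_zero_poly)
  consider "norm q < 1" | "norm q = 1" | "norm q > 1" by linarith
  then show "count C q = count C' q"
  proof cases
    case 1
    then show ?thesis using o order_pole_poly_ball assms by simp
  next
    case 2
    then show ?thesis using o order_pole_poly_sphere by simp
  next
    case 3
    then have "q \<notin># C" "q \<notin># C'" using assms(1,2) by auto
    then show ?thesis by (simp add: not_in_iff)
  qed
qed

text \<open>For points on the circle the coefficient \<open>1 - x * cnj x\<close> in
  \<open>crit_poly_add_mset\<close> is 0. This is the source of the summand \<open>D2\<close> in the
  formula for the extension.\<close>

lemma crit_poly_union_sphere:
  assumes "set_mset D2 \<subseteq> sphere 0 1"
  shows "crit_poly m (D1 + D2) = crit_poly m D1 * (zero_poly D2 * pole_poly D2)"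
  using assms
proof (induction D2)
  case (add x D2)
  then have "x * cnj x = 1" by (simp add: complex_norm_square[symmetric])
  then show ?case using add
    by (simp add: crit_poly_add_mset zero_poly_add_mset pole_poly_add_mset ac_simps del: mult_pCons_left mult_pCons_right)
qed simp

text \<open>In the recursion \<open>crit_poly_add_mset\<close> both
  \<open>(z - x) * (1 - cnj x * z)\<close> and the monomial \<open>z\<close> are invariant under
  reflection with weight \<open>z\<^sup>2\<close>, and \<open>1 - x * cnj x\<close> is real.\<close>

lemma crit_poly_reflect:
  assumes z: "z \<noteq> 0"
  shows "z ^ (2 * size D) * cnj (poly (crit_poly m D) (1 / cnj z)) = poly (crit_poly m D) z"
proof (induction D)
  case (add x D)
  define w where "w = 1 / cnj z"
  have w: "cnj w = 1 / z" by (simp add: w_def)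
  have G: "z ^ (2 * size D) * (cnj (poly (zero_poly D) w) * cnj (poly (pole_poly D) w)) =
      poly (zero_poly D) z * poly (pole_poly D) z"
    unfolding poly_pole_poly_reflect[OF z, of D, symmetric] poly_zero_poly_reflect[OF z, of D, symmetric]
    by (simp only: w_def power_add mult_2) (simp only: mult_ac)
  have IH: "z ^ (2 * size D) * cnj (poly (crit_poly m D) w) = poly (crit_poly m D) z"
    using add by (simp add: w_def)
  have q: "z\<^sup>2 * cnj ((w - x) * (1 - cnj x * w)) = (z - x) * (1 - cnj x * z)"
    using z by (simp add: w field_simps power2_eq_square)
  have "z ^ (2 * size (add_mset x D)) * cnj (poly (crit_poly m (add_mset x D)) w) =
     (z\<^sup>2 * cnj ((w - x) * (1 - cnj x * w))) * (z ^ (2 * size D) * cnj (poly (crit_poly m D) w))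
     + (z\<^sup>2 * cnj w) * (1 - x * cnj x) * (z ^ (2 * size D) * (cnj (poly (zero_poly D) w) * cnj (poly (pole_poly D) w)))"
    by (simp add: crit_poly_add_mset power_add algebra_simps power2_eq_square)
  also have "\<dots> = (z - x) * (1 - cnj x * z) * poly (crit_poly m D) z
     + z * (1 - x * cnj x) * (poly (zero_poly D) z * poly (pole_poly D) z)"
    unfolding G IH q using z by (simp add: w power2_eq_square)
  also have "\<dots> = poly (crit_poly m (add_mset x D)) z"
    by (simp add: crit_poly_add_mset algebra_simps)
  finally show ?case by (simp add: w_def)
qed simp

text \<open>\<open>k\<close> is the diagonal of the kernel \<open>(Q(z) cnj Q(w) - A(z) cnj A(w)) / (1 - z cnj w)\<close>, \<open>A = z\<^sup>m P\<close>. Its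
  boundary values are those of \<open>|F|\<close>, which is why the quotient of densities tends to 1.\<close>

lemma blaschke_kernel:
  assumes "m \<ge> 1" "set_mset D \<subseteq> ball 0 1"
  obtains k :: "complex \<Rightarrow> real" where
    "continuous_on UNIV k"
    "\<And>z. (norm (poly (pole_poly D) z))\<^sup>2 - (norm (z ^ m * poly (zero_poly D) z))\<^sup>2 = (1 - (norm z)\<^sup>2) * k z"
    "\<And>z. norm z \<le> 1 \<Longrightarrow> k z > 0"
    "\<And>z. norm z = 1 \<Longrightarrow> poly (crit_poly m D) z = z ^ size D * of_real (k z)"
proof -
  have "\<exists>k. continuous_on UNIV k \<and>
    (\<forall>z. (norm (poly (pole_poly D) z))\<^sup>2 - (norm (z ^ m * poly (zero_poly D) z))\<^sup>2 = (1 - (norm z)\<^sup>2) * k z) \<and>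
    (\<forall>z. norm z \<le> 1 \<longrightarrow> k z > 0) \<and>
    (\<forall>z. norm z = 1 \<longrightarrow> poly (crit_poly m D) z = z ^ size D * of_real (k z))"
    using assms(2)
  proof (induction D)
    case empty
    \<comment> \<open>The geometric sum for the quotient of \<open>1 - (norm z) ^ (2 * m)\<close> by
      \<open>1 - (norm z)\<^sup>2\<close>. Its term for \<open>i = 0\<close> exists because
      \<open>m \<ge> 1\<close> and makes it positive; on the circle its value is
      \<open>m\<close>.\<close>
    let ?k = "\<lambda>z::complex. \<Sum>i<m. ((norm z)\<^sup>2) ^ i"
    have "?k z > 0" for z
    proof -
      have "?k z \<ge> (\<Sum>i\<in>{0}. ((norm z)\<^sup>2) ^ i)"
        using \<open>m \<ge> 1\<close> by (intro sum_mono2) auto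
      then show ?thesis by simp
    qed
    moreover have "1 - ((norm z)\<^sup>2) ^ m = (1 - (norm z)\<^sup>2) * ?k z" for z
      using one_diff_power_eq by blast
    ultimately show ?case
      by (intro exI[of _ ?k]) (auto intro!: continuous_intros simp: norm_power power_mult[symmetric] mult.commute)
  next
    case (add x D)
    then obtain k where k: "continuous_on UNIV k"
      "\<And>z. (norm (poly (pole_poly D) z))\<^sup>2 - (norm (z ^ m * poly (zero_poly D) z))\<^sup>2 = (1 - (norm z)\<^sup>2) * k z"
      "\<And>z. norm z \<le> 1 \<Longrightarrow> k z > 0"
      "\<And>z. norm z = 1 \<Longrightarrow> poly (crit_poly m D) z = z ^ size D * of_real (k z)"
      by auto
    \<comment> \<open>Add and subtract \<open>(norm (1 - cnj x * z))\<^sup>2\<close> times the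
      squared norm of \<open>z ^ m * P\<close> in the difference for \<open>add_mset x D\<close>;
      identity \<open>1\<close> below extracts \<open>1 - (norm z)\<^sup>2\<close> from the second
      part.\<close>
    define k' where "k' = (\<lambda>z. (norm (1 - cnj x * z))\<^sup>2 * k z + (1 - (norm x)\<^sup>2) * (norm (z ^ m * poly (zero_poly D) z))\<^sup>2)"
    have x: "norm x < 1" using add.prems by simp
    then have x2: "1 - (norm x)\<^sup>2 > 0" by (simp add: abs_square_less_1)
    have 1: "(norm (1 - cnj x * z))\<^sup>2 - (norm (z - x))\<^sup>2 = (1 - (norm x)\<^sup>2) * (1 - (norm z)\<^sup>2)" for z
      unfolding cmod_power2 by (simp add: power2_eq_square algebra_simps)
    have "(norm (poly (pole_poly (add_mset x D)) z))\<^sup>2 - (norm (z ^ m * poly (zero_poly (add_mset x D)) z))\<^sup>2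
          = (1 - (norm z)\<^sup>2) * k' z" for z
    proof -
      have "(norm (poly (pole_poly (add_mset x D)) z))\<^sup>2 - (norm (z ^ m * poly (zero_poly (add_mset x D)) z))\<^sup>2
        = (norm (1 - cnj x * z))\<^sup>2 * (norm (poly (pole_poly D) z))\<^sup>2 - (norm (z - x))\<^sup>2 * (norm (z ^ m * poly (zero_poly D) z))\<^sup>2"
        by (simp add: poly_pole_poly poly_zero_poly norm_mult power_mult_distrib)
      also have "\<dots> = (norm (1 - cnj x * z))\<^sup>2 * ((norm (poly (pole_poly D) z))\<^sup>2 - (norm (z ^ m * poly (zero_poly D) z))\<^sup>2)
         + ((norm (1 - cnj x * z))\<^sup>2 - (norm (z - x))\<^sup>2) * (norm (z ^ m * poly (zero_poly D) z))\<^sup>2"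
        by (simp only: algebra_simps)
      also have "\<dots> = (1 - (norm z)\<^sup>2) * k' z" unfolding k(2) 1 by (simp add: k'_def algebra_simps)
      finally show ?thesis .
    qed
    moreover have "k' z > 0" if "norm z \<le> 1" for z
      unfolding k'_def using k(3)[OF that] x2 one_minus_cnj_mult_nonzero[OF x that]
      by (intro add_pos_nonneg) auto
    moreover have "poly (crit_poly m (add_mset x D)) z = z ^ size (add_mset x D) * of_real (k' z)" if z: "norm z = 1" for z
    proof -
      have z0: "z \<noteq> 0" "z * cnj z = 1" using z by (auto simp: complex_norm_square[symmetric])
      then have zc: "1 / cnj z = z" by (simp add: field_simps)
      define p u where "p = poly (zero_poly D) z" and "u = 1 - cnj x * z"
      \<comment> \<open>A point of the circle is its own reflection, so up to a power of
        \<open>z\<close> the value of the pole polynomial is the conjugate of that of the zero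
        polynomial. The same holds for the single factors \<open>z - x\<close> and
        \<open>u\<close>.\<close>
      have q: "poly (pole_poly D) z = z ^ size D * cnj p"
        using poly_pole_poly_reflect[OF z0(1), of D] zc by (simp add: p_def)
      have u: "z - x = z * cnj u"
        using z0 by (simp add: u_def algebra_simps)
      have "norm (z ^ m * p) = norm p"
        using z by (simp add: norm_mult norm_power)
      then have k': "complex_of_real (k' z) = u * cnj u * of_real (k z) + (1 - x * cnj x) * (p * cnj p)"
        by (simp add: k'_def p_def[symmetric] u_def[symmetric] del: complex_cnj_diff flip: complex_norm_square)
      have "poly (crit_poly m (add_mset x D)) z = (z - x) * u * poly (crit_poly m D) z
          + (1 - x * cnj x) * (z * (p * poly (pole_poly D) z))"
        by (simp add: crit_poly_add_mset p_def u_def algebra_simps)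
      also have "\<dots> = z ^ size (add_mset x D) * of_real (k' z)"
        unfolding k(4)[OF z] q u k' by (simp add: algebra_simps)
      finally show ?thesis .
    qed
    moreover have "continuous_on UNIV k'"
      unfolding k'_def by (intro continuous_intros k(1))
    ultimately show ?case by blast
  qed
  then show ?thesis using that by blast
qed

section \<open>The maximum principle for quotients of densities\<close>

text \<open>The difference \<open>f - \<phi> * g\<close> vanishes at \<open>z0\<close> and has
  derivative \<open>- deriv \<phi> * g\<close>. If \<open>g\<close> has a zero of order
  \<open>n\<close>, the difference is therefore of order at least \<open>n + 1\<close>, negligible
  against \<open>g\<close>; near \<open>z0\<close> the size of \<open>f\<close> is that of
  \<open>\<phi> * g\<close>, and \<open>\<phi>\<close> has norm above 1.\<close>

lemma eventually_norm_less_of_deriv_ratio: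
  assumes r: "r > 0"
    and hol: "f holomorphic_on ball z0 r" "g holomorphic_on ball z0 r" "\<phi> holomorphic_on ball z0 r"
    and deriv: "\<And>z. z \<in> ball z0 r \<Longrightarrow> deriv f z = \<phi> z * deriv g z"
    and z0: "f z0 = 0" "g z0 = 0" "norm (\<phi> z0) > 1"
    and nz: "\<exists>z\<in>ball z0 r. g z \<noteq> 0"
  shows "eventually (\<lambda>z. norm (g z) < norm (f z)) (at z0)"
proof -
  have nc: "\<not> g constant_on ball z0 r"
    using nz z0 r unfolding constant_on_def by (metis centre_in_ball)
  have z0in: "z0 \<in> ball z0 r" using r by simp
  obtain \<beta> s n where n: "0 < n" and s: "0 < s" "ball z0 s \<subseteq> ball z0 r" and \<beta>: "\<beta> holomorphic_on ball z0 s"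
    "\<And>w. w \<in> ball z0 s \<Longrightarrow> g w = (w - z0) ^ n * \<beta> w" "\<And>w. w \<in> ball z0 s \<Longrightarrow> \<beta> w \<noteq> 0"
    by (rule holomorphic_factor_zero_nonconstant[OF hol(2) open_ball connected_ball z0in z0(2) nc]) (rule that; assumption)
  define \<rho> where "\<rho> = s / 2"
  have \<rho>: "\<rho> > 0" "cball z0 \<rho> \<subseteq> ball z0 s" using s by (auto simp: \<rho>_def)
  have c\<beta>: "continuous_on (cball z0 \<rho>) \<beta>"
    using \<beta>(1) \<rho>(2) holomorphic_on_imp_continuous_on continuous_on_subset by blast
  have bnd: "\<exists>B. \<forall>w\<in>cball z0 \<rho>. norm (h w) \<le> B" if "continuous_on (cball z0 \<rho>) h" for h :: "complex \<Rightarrow> complex"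
    using compact_imp_bounded[OF compact_continuous_image[OF that compact_cball]] by (auto simp: bounded_iff)
  obtain B where B: "\<And>w. w \<in> cball z0 \<rho> \<Longrightarrow> norm (\<beta> w) \<le> B"
    using bnd[OF c\<beta>] by blast
  obtain w0 where w0: "w0 \<in> cball z0 \<rho>" "\<And>w. w \<in> cball z0 \<rho> \<Longrightarrow> norm (\<beta> w0) \<le> norm (\<beta> w)"
    using continuous_attains_inf[OF compact_cball _ continuous_on_norm[OF c\<beta>]] \<rho>(1) by auto
  define b where "b = norm (\<beta> w0)"
  have b: "b > 0" "\<And>w. w \<in> cball z0 \<rho> \<Longrightarrow> b \<le> norm (\<beta> w)"
    using w0 \<beta>(3) \<rho>(2) by (auto simp: b_def)
  have "deriv \<phi> holomorphic_on ball z0 r"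
    by (intro holomorphic_deriv hol open_ball)
  then have "continuous_on (cball z0 \<rho>) (deriv \<phi>)"
    using \<rho>(2) s(2) holomorphic_on_imp_continuous_on continuous_on_subset by blast
  then obtain M where M: "\<And>w. w \<in> cball z0 \<rho> \<Longrightarrow> norm (deriv \<phi> w) \<le> M"
    using bnd by blast
  have M0: "M \<ge> 0" and B0: "B \<ge> 0"
    using order_trans[OF norm_ge_zero M[of z0]] order_trans[OF norm_ge_zero B[of z0]] \<rho> by auto
  have est: "norm (f z - \<phi> z * g z) \<le> M * B / b * dist z0 z * norm (g z)" if z: "z \<in> cball z0 \<rho>" for z
  proof -
    define d where "d = dist z0 z"
    have d: "cball z0 d \<subseteq> cball z0 \<rho>" "d \<ge> 0" using z by (auto simp: d_def)
    have "norm ((f z - \<phi> z * g z) - (f z0 - \<phi> z0 * g z0)) \<le> M * (d ^ n * B) * norm (z - z0)"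
    proof (rule field_differentiable_bound[where S = "cball z0 d" and f' = "\<lambda>w. - (deriv \<phi> w * g w)"])
      fix w assume w: "w \<in> cball z0 d"
      then have w': "w \<in> ball z0 r" "w \<in> ball z0 s" "w \<in> cball z0 \<rho>"
        using d(1) \<rho>(2) s(2) w by blast+
      have D: "(f has_field_derivative deriv f w) (at w)" "(g has_field_derivative deriv g w) (at w)"
        "(\<phi> has_field_derivative deriv \<phi> w) (at w)"
        using hol w'(1) by (auto intro!: holomorphic_derivI[where S = "ball z0 r"])
      have "((\<lambda>w. f w - \<phi> w * g w) has_field_derivative - (deriv \<phi> w * g w)) (at w)"
        by (rule derivative_eq_intros D)+ (use deriv[OF w'(1)] in \<open>auto simp: algebra_simps\<close>)
      then show "((\<lambda>w. f w - \<phi> w * g w) has_field_derivative - (deriv \<phi> w * g w)) (at w within cball z0 d)"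
        using has_field_derivative_at_within by blast
      have "norm (w - z0) \<le> d" using w by (simp add: dist_norm norm_minus_commute)
      then have "norm (g w) \<le> d ^ n * B"
        unfolding \<beta>(2)[OF w'(2)] norm_mult norm_power
        using B[OF w'(3)] B0 d by (intro mult_mono power_mono) auto
      then show "norm (- (deriv \<phi> w * g w)) \<le> M * (d ^ n * B)"
        using M[OF w'(3)] M0 by (simp add: norm_mult mult_mono)
    qed (use d in \<open>auto simp: d_def\<close>)
    also have "\<dots> = M * B * d * d ^ n" by (simp add: d_def dist_norm norm_minus_commute)
    \<comment> \<open>The lower bound \<open>b\<close> for the zero-free factor
      \<open>\<beta>\<close> turns the power of the distance back into
      \<open>norm (g z)\<close>.\<close>
    also have "d ^ n \<le> norm (g z) / b"
    proof -
      have "d ^ n * b \<le> d ^ n * norm (\<beta> z)" using b(2)[OF z] d by (intro mult_left_mono) auto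
      also have "\<dots> = norm (g z)"
        by (simp add: \<beta>(2)[OF subsetD[OF \<rho>(2) z]] norm_mult norm_power d_def dist_norm norm_minus_commute)
      finally show ?thesis using b(1) by (simp add: field_simps)
    qed
    then have "M * B * d * d ^ n \<le> M * B * d * (norm (g z) / b)"
      using M0 B0 d by (intro mult_left_mono) auto
    finally show ?thesis using z0 by (simp add: d_def)
  qed
  have "continuous (at z0) \<phi>"
    using hol(3) r by (metis centre_in_ball continuous_on_eq_continuous_at holomorphic_on_imp_continuous_on open_ball)
  then have "((\<lambda>z. norm (\<phi> z) - M * B / b * dist z0 z) \<longlongrightarrow> norm (\<phi> z0) - M * B / b * dist z0 z0) (at z0)"
    by (intro tendsto_intros) (simp add: isCont_def)
  then have ev1: "eventually (\<lambda>z. norm (\<phi> z) - M * B / b * dist z0 z > 1) (at z0)"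
    using z0(3) by (intro order_tendstoD(1)[where a = 1]) auto
  have ev2: "eventually (\<lambda>z. z \<in> ball z0 \<rho> - {z0}) (at z0)"
    using \<rho> eventually_at_in_open[of "ball z0 \<rho>" z0] by simp
  show ?thesis using ev1 ev2
  proof eventually_elim
    case (elim z)
    then have z: "z \<in> cball z0 \<rho>" "z \<noteq> z0" "z \<in> ball z0 s" using s(1) by (auto simp: \<rho>_def)
    have g: "norm (g z) > 0" using \<beta>(2,3)[OF z(3)] z by simp
    have "norm (g z) < (norm (\<phi> z) - M * B / b * dist z0 z) * norm (g z)"
      using elim(1) g by simp
    also have "\<dots> = norm (\<phi> z * g z) - M * B / b * dist z0 z * norm (g z)"
      by (simp add: norm_mult algebra_simps)
    also have "\<dots> \<le> norm (\<phi> z * g z) - norm (f z - \<phi> z * g z)" using est[OF z(1)] by simp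
    also have "\<dots> \<le> norm (f z)" by (metis add.commute diff_le_eq norm_minus_commute norm_triangle_sub)
    finally show ?case .
  qed
qed

text \<open>Near \<open>z0\<close> the factors involving \<open>f\<close> and \<open>g\<close> decrease the density quotient strictly, so \<open>|\<phi>|\<close> would
  have a strict local maximum.\<close>

lemma no_centered_interior_max:
  assumes r: "r > 0"
    and hol: "f holomorphic_on ball z0 r" "g holomorphic_on ball z0 r" "\<phi> holomorphic_on ball z0 r"
    and deriv: "\<And>z. z \<in> ball z0 r \<Longrightarrow> deriv f z = \<phi> z * deriv g z"
    and z0: "f z0 = 0" "g z0 = 0" "norm (\<phi> z0) > 1"
    and nz: "\<exists>z\<in>ball z0 r. g z \<noteq> 0"
    and lt: "\<And>z. z \<in> ball z0 r \<Longrightarrow> norm (g z) < 1"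
    and max: "\<And>z. z \<in> ball z0 r \<Longrightarrow> norm (\<phi> z) * (1 - (norm (g z))\<^sup>2) \<le> norm (\<phi> z0) * (1 - (norm (f z))\<^sup>2)"
  shows False
proof -
  obtain s where s: "s > 0" "\<And>z. z \<in> ball z0 s \<Longrightarrow> z \<noteq> z0 \<Longrightarrow> norm (g z) < norm (f z)"
    using eventually_norm_less_of_deriv_ratio[OF r hol deriv z0 nz] unfolding eventually_at
    by (auto simp: dist_commute)
  define t where "t = min r s"
  have t: "t > 0" "ball z0 t \<subseteq> ball z0 r" "ball z0 t \<subseteq> ball z0 s" using r s by (auto simp: t_def)
  have less: "norm (\<phi> z) < norm (\<phi> z0)" if z: "z \<in> ball z0 t" "z \<noteq> z0" for z
  proof -
    have zr: "z \<in> ball z0 r" "z \<in> ball z0 s" using z t by auto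
    have "norm (\<phi> z) * (1 - (norm (g z))\<^sup>2) \<le> norm (\<phi> z0) * (1 - (norm (f z))\<^sup>2)" by (rule max[OF zr(1)])
    also have "\<dots> < norm (\<phi> z0) * (1 - (norm (g z))\<^sup>2)"
      using s(2)[OF zr(2) z(2)] z0(3)
      by (intro mult_strict_left_mono diff_strict_left_mono power_strict_mono) auto
    finally show ?thesis using lt[OF zr(1)] by (simp add: abs_square_less_1)
  qed
  have "\<phi> constant_on ball z0 t"
  proof (rule maximum_modulus_principle[where U = "ball z0 t" and \<xi> = z0])
    show "\<phi> holomorphic_on ball z0 t" using hol(3) t(2) holomorphic_on_subset by blast
    show "norm (\<phi> z) \<le> norm (\<phi> z0)" if "z \<in> ball z0 t" for z
      using less[OF that] by (cases "z = z0") auto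
  qed (use t in auto)
  moreover have "z0 + of_real (t / 2) \<in> ball z0 t" "z0 + of_real (t / 2) \<noteq> z0" using t by (auto simp: dist_norm)
  ultimately show False using less t(1) unfolding constant_on_def
    by (metis centre_in_ball less_irrefl)
qed

section \<open>Invariance under disk automorphisms\<close>

lemma one_minus_norm_moebius:
  assumes "1 - cnj a * w \<noteq> 0"
  shows "1 - (norm ((w - a) / (1 - cnj a * w)))\<^sup>2 = (1 - (norm a)\<^sup>2) * (1 - (norm w)\<^sup>2) / (norm (1 - cnj a * w))\<^sup>2"
proof -
  have "(norm (1 - cnj a * w))\<^sup>2 - (norm (w - a))\<^sup>2 = (1 - (norm a)\<^sup>2) * (1 - (norm w)\<^sup>2)"
    unfolding cmod_power2 by (simp add: power2_eq_square algebra_simps)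
  then show ?thesis using assms by (simp add: norm_divide power_divide field_simps)
qed

text \<open>The density quotient is invariant under disk automorphisms applied to \<open>f\<close> and \<open>g\<close>, which reduces this
  to \<open>f z0 = g z0 = 0\<close>.\<close>

lemma no_interior_max:
  assumes r: "r > 0"
    and hol: "f holomorphic_on ball z0 r" "g holomorphic_on ball z0 r" "\<phi> holomorphic_on ball z0 r"
    and deriv: "\<And>z. z \<in> ball z0 r \<Longrightarrow> deriv f z = \<phi> z * deriv g z"
    and lt: "\<And>z. z \<in> ball z0 r \<Longrightarrow> norm (f z) < 1" "\<And>z. z \<in> ball z0 r \<Longrightarrow> norm (g z) < 1"
    and gt: "norm (\<phi> z0) * (1 - (norm (g z0))\<^sup>2) > 1 - (norm (f z0))\<^sup>2"
    and nz: "\<exists>z\<in>ball z0 r. g z \<noteq> g z0"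
    and max: "\<And>z. z \<in> ball z0 r \<Longrightarrow>
      norm (\<phi> z) * (1 - (norm (g z))\<^sup>2) / (1 - (norm (f z))\<^sup>2) \<le>
      norm (\<phi> z0) * (1 - (norm (g z0))\<^sup>2) / (1 - (norm (f z0))\<^sup>2)"
  shows False
proof -
  define a b where "a = f z0" and "b = g z0"
  have ab: "norm a < 1" "norm b < 1" using lt[of z0] r by (auto simp: a_def b_def)
  have ab2: "1 - (norm a)\<^sup>2 > 0" "1 - (norm b)\<^sup>2 > 0" using ab by (auto simp: abs_square_less_1)
  define F G where "F = (\<lambda>z. (f z - a) / (1 - cnj a * f z))" and "G = (\<lambda>z. (g z - b) / (1 - cnj b * g z))"
  \<comment> \<open>The map sending \<open>w\<close> to \<open>(w - c) / (1 - cnj c * w)\<close> has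
    derivative \<open>(1 - (norm c)\<^sup>2) / (1 - cnj c * w)\<^sup>2\<close>. Thus
    \<open>\<Phi>\<close> is the factor that relates \<open>deriv F\<close> to
    \<open>deriv G\<close>, and \<open>K\<close> collects the constants for \<open>a\<close> and
    \<open>b\<close>.\<close>
  define K where "K = (1 - (norm a)\<^sup>2) / (1 - (norm b)\<^sup>2)"
  have K: "K > 0" using ab2 by (simp add: K_def)
  define \<Phi> where "\<Phi> = (\<lambda>z. \<phi> z * of_real K * (1 - cnj b * g z)\<^sup>2 / (1 - cnj a * f z)\<^sup>2)"
  have nf: "1 - cnj a * f z \<noteq> 0" and ng: "1 - cnj b * g z \<noteq> 0" if "z \<in> ball z0 r" for z
    using one_minus_cnj_mult_nonzero ab lt[OF that] by (auto simp: less_imp_le)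
  have F0: "F z0 = 0" "G z0 = 0" by (simp_all add: F_def G_def a_def b_def)
  have n\<Phi>: "norm (\<Phi> z) = norm (\<phi> z) * K * (norm (1 - cnj b * g z))\<^sup>2 / (norm (1 - cnj a * f z))\<^sup>2" for z
    using K by (simp add: \<Phi>_def norm_mult norm_divide norm_power)
  have nz0: "norm (1 - cnj c * c) = 1 - (norm c)\<^sup>2" if "norm c < 1" for c :: complex
  proof -
    have "1 - cnj c * c = of_real (1 - (norm c)\<^sup>2)"
      by (simp add: mult.commute[of "cnj c"] flip: complex_norm_square)
    moreover have "(norm c)\<^sup>2 \<le> 1" using that by (simp add: abs_square_le_1)
    ultimately show ?thesis by (simp only: norm_of_real)
  qed
  have n\<Phi>0: "norm (\<Phi> z0) = norm (\<phi> z0) * (1 - (norm b)\<^sup>2) / (1 - (norm a)\<^sup>2)"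
    using ab2 unfolding n\<Phi> a_def[symmetric] b_def[symmetric] nz0[OF ab(1)] nz0[OF ab(2)] K_def
    by (simp add: power2_eq_square)
  show False
  proof (rule no_centered_interior_max[OF r, of F _ G \<Phi>])
    show "F holomorphic_on ball z0 r" "G holomorphic_on ball z0 r" "\<Phi> holomorphic_on ball z0 r"
      unfolding F_def G_def \<Phi>_def using nf ng by (auto intro!: holomorphic_intros hol)
    show "F z0 = 0" "G z0 = 0" by (fact F0)+
    show "norm (\<Phi> z0) > 1" using gt ab2 unfolding n\<Phi>0 by (simp add: a_def b_def field_simps)
    show "\<exists>z\<in>ball z0 r. G z \<noteq> 0" using nz ng by (auto simp: G_def b_def)
    fix z assume z: "z \<in> ball z0 r"
    note nfz = nf[OF z] and ngz = ng[OF z]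
    have D: "(f has_field_derivative deriv f z) (at z)" "(g has_field_derivative deriv g z) (at z)"
      using hol z by (auto intro!: holomorphic_derivI[where S = "ball z0 r"])
    have moeb: "((\<lambda>z. (h z - c) / (1 - cnj c * h z)) has_field_derivative
        of_real (1 - (norm c)\<^sup>2) * h' / (1 - cnj c * h z)\<^sup>2) (at z)"
      if "(h has_field_derivative h') (at z)" "1 - cnj c * h z \<noteq> 0" for h h' c
    proof -
      have "((\<lambda>z. (h z - c) / (1 - cnj c * h z)) has_field_derivative
        (h' * (1 - cnj c * h z) - (h z - c) * (- cnj c * h')) / ((1 - cnj c * h z) * (1 - cnj c * h z))) (at z)"
        by (rule derivative_eq_intros that refl)+ (simp_all add: that)
      moreover have "h' * (1 - cnj c * h z) - (h z - c) * (- cnj c * h') = of_real (1 - (norm c)\<^sup>2) * h'"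
        unfolding of_real_diff complex_norm_square by (simp add: algebra_simps)
      ultimately show ?thesis by (simp add: power2_eq_square)
    qed
    have dF: "deriv F z = of_real (1 - (norm a)\<^sup>2) * deriv f z / (1 - cnj a * f z)\<^sup>2"
      unfolding F_def by (intro DERIV_imp_deriv moeb D nfz)
    have dG: "deriv G z = of_real (1 - (norm b)\<^sup>2) * deriv g z / (1 - cnj b * g z)\<^sup>2"
      unfolding G_def by (intro DERIV_imp_deriv moeb D ngz)
    have ab2c: "complex_of_real (1 - (norm b)\<^sup>2) \<noteq> 0" using ab2 by (metis less_irrefl of_real_eq_0_iff)
    have Kc: "complex_of_real K * of_real (1 - (norm b)\<^sup>2) = of_real (1 - (norm a)\<^sup>2)"
      unfolding of_real_mult[symmetric] using ab2 by (simp add: K_def)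
    have "\<Phi> z * deriv G z = \<phi> z * (complex_of_real K * of_real (1 - (norm b)\<^sup>2)) * deriv g z / (1 - cnj a * f z)\<^sup>2"
      unfolding dG \<Phi>_def using ngz nfz by (simp add: field_simps del: of_real_diff of_real_mult)
    then show "deriv F z = \<Phi> z * deriv G z"
      unfolding dF Kc deriv[OF z] by simp
    have lt2: "1 - (norm (f z))\<^sup>2 > 0" "1 - (norm (g z))\<^sup>2 > 0" using lt z by (auto simp: abs_square_less_1)
    have mF: "1 - (norm (F z))\<^sup>2 = (1 - (norm a)\<^sup>2) * (1 - (norm (f z))\<^sup>2) / (norm (1 - cnj a * f z))\<^sup>2"
      unfolding F_def by (rule one_minus_norm_moebius[OF nfz])
    have mG: "1 - (norm (G z))\<^sup>2 = (1 - (norm b)\<^sup>2) * (1 - (norm (g z))\<^sup>2) / (norm (1 - cnj b * g z))\<^sup>2"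
      unfolding G_def by (rule one_minus_norm_moebius[OF ngz])
    have "1 - (norm (G z))\<^sup>2 > 0" unfolding mG using lt2 ab2 ngz by simp
    then show "norm (G z) < 1" by (simp add: abs_square_less_1)
    have "norm (\<Phi> z) * (1 - (norm (G z))\<^sup>2) = norm (\<phi> z) * (1 - (norm (g z))\<^sup>2) * ((1 - (norm a)\<^sup>2) / (norm (1 - cnj a * f z))\<^sup>2)"
    proof -
      have "p * (\<alpha> / \<beta>) * u / v * (\<beta> * \<gamma> / u) = p * \<gamma> * (\<alpha> / v)" if "\<beta> \<noteq> 0" "u \<noteq> 0" for p \<alpha> \<beta> \<gamma> u v :: real
        using that by simp
      then show ?thesis unfolding n\<Phi> mG K_def using ngz ab2 by (metis less_irrefl norm_eq_zero power_eq_0_iff)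
    qed
    also have "norm (\<phi> z) * (1 - (norm (g z))\<^sup>2) \<le> norm (\<Phi> z0) * (1 - (norm (f z))\<^sup>2)"
      using max[OF z] unfolding pos_divide_le_eq[OF lt2(1)] n\<Phi>0 a_def b_def .
    then have "norm (\<phi> z) * (1 - (norm (g z))\<^sup>2) * ((1 - (norm a)\<^sup>2) / (norm (1 - cnj a * f z))\<^sup>2) \<le>
       norm (\<Phi> z0) * (1 - (norm (f z))\<^sup>2) * ((1 - (norm a)\<^sup>2) / (norm (1 - cnj a * f z))\<^sup>2)"
      using ab2 by (intro mult_right_mono) auto
    also have "\<dots> = norm (\<Phi> z0) * (1 - (norm (F z))\<^sup>2)" unfolding mF by simp
    finally show "norm (\<Phi> z) * (1 - (norm (G z))\<^sup>2) \<le> norm (\<Phi> z0) * (1 - (norm (F z))\<^sup>2)" .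
  qed
qed

section \<open>Polynomial identities in a variable and its conjugate\<close>

lemma poly_eq_0_of_real_interval:
  fixes p :: "complex poly"
  assumes "r > 0" "\<And>x::real. \<bar>x\<bar> < r \<Longrightarrow> poly p (of_real x) = 0"
  shows "p = 0"
proof (rule ccontr)
  assume "p \<noteq> 0"
  then have "finite {x. poly p x = 0}" by (rule poly_roots_finite)
  moreover have "complex_of_real ` {-r<..<r} \<subseteq> {x. poly p x = 0}" using assms by auto
  ultimately have "finite (complex_of_real ` {-r<..<r})" by (rule finite_subset[rotated])
  then have "finite {-r<..<r}" by (subst (asm) finite_image_iff) (auto intro: injI inj_on_subset[OF inj_of_real])
  then show False using \<open>r > 0\<close> infinite_Ioo[of "-r" r] by simp
qed

text \<open>For \<open>z = x + \<i> * y\<close> the hypothesis is a polynomial identity in small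
  real \<open>x\<close> and \<open>y\<close>. It extends to all complex \<open>x\<close> for fixed
  \<open>y\<close>, then to all complex \<open>y\<close> for fixed \<open>x\<close>; finally
  \<open>x + \<i> * y\<close> and \<open>x - \<i> * y\<close> take arbitrary values \<open>z\<close>
  and \<open>w\<close>.\<close>

lemma polarization:
  fixes L :: "(complex poly \<times> complex poly) list"
  assumes r: "r > 0" and zero: "\<And>z. norm z < r \<Longrightarrow> (\<Sum>(a, b)\<leftarrow>L. poly a z * poly b (cnj z)) = 0"
  shows "(\<Sum>(a, b)\<leftarrow>L. poly a z * poly b w) = 0"
proof -
  define h where "h = r / 2"
  have small: "norm (of_real x + \<i> * of_real y) < r" if "\<bar>x\<bar> < h" "\<bar>y\<bar> < h" for x y :: real
    using norm_triangle_ineq[of "of_real x" "\<i> * of_real y"] that by (simp add: h_def norm_mult)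
  have sum_poly: "poly (\<Sum>(a, b)\<leftarrow>L. pcompose a u * pcompose b v) x = (\<Sum>(a, b)\<leftarrow>L. poly a (poly u x) * poly b (poly v x))"
    for u v x by (induction L) (auto simp: poly_pcompose)
  have 1: "(\<Sum>(a, b)\<leftarrow>L. pcompose a [:\<i> * of_real y, 1:] * pcompose b [:- \<i> * of_real y, 1:]) = 0" if y: "\<bar>y\<bar> < h" for y :: real
  proof (rule poly_eq_0_of_real_interval)
    show "h > 0" using r by (simp add: h_def)
    show "poly (\<Sum>(a, b)\<leftarrow>L. pcompose a [:\<i> * of_real y, 1:] * pcompose b [:- \<i> * of_real y, 1:]) (of_real x) = 0" if "\<bar>x\<bar> < h" for x
      using zero[OF small[OF that y]] unfolding sum_poly by (simp add: add.commute)
  qed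
  have 2: "(\<Sum>(a, b)\<leftarrow>L. pcompose a [:x, \<i>:] * pcompose b [:x, - \<i>:]) = 0" for x
  proof (rule poly_eq_0_of_real_interval)
    show "h > 0" using r by (simp add: h_def)
    show "poly (\<Sum>(a, b)\<leftarrow>L. pcompose a [:x, \<i>:] * pcompose b [:x, - \<i>:]) (of_real y) = 0" if "\<bar>y\<bar> < h" for y
      using arg_cong[OF 1[OF that], of "\<lambda>p. poly p x"] unfolding sum_poly by (simp add: add.commute mult.commute)
  qed
  show ?thesis
    using arg_cong[OF 2[of "(z + w) / 2"], of "\<lambda>p. poly p ((z - w) / (2 * \<i>))"] unfolding sum_poly
    by (simp add: field_simps)
qed

section \<open>A divisor is determined by its critical polynomial\<close>

lemma poly_eq_if_nonzero_eq:
  fixes p q :: "complex poly"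
  assumes "\<And>z. z \<noteq> 0 \<Longrightarrow> poly p z = poly q z"
  shows "p = q"
proof -
  have "poly (p * [:0, 1:]) z = poly (q * [:0, 1:]) z" for z using assms by (cases "z = 0") auto
  then have "p * [:0, 1:] = q * [:0, 1:]" by (metis poly_eq_poly_eq_iff ext)
  then show ?thesis by simp
qed

lemma has_field_derivative_blaschke:
  assumes "m \<ge> 1" "poly (pole_poly D) z \<noteq> 0"
  shows "((\<lambda>z. z ^ m * poly (zero_poly D) z / poly (pole_poly D) z) has_field_derivative
      z ^ (m - 1) * poly (crit_poly m D) z / (poly (pole_poly D) z)\<^sup>2) (at z)"
proof -
  obtain l where l: "m = Suc l" using assms(1) by (cases m) auto
  show ?thesis
    by (rule derivative_eq_intros poly_DERIV refl)+
       (use assms(2) in \<open>simp_all add: l crit_poly_def power2_eq_square algebra_simps\<close>)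
qed

text \<open>On the circle the critical polynomial has the modulus of the positive kernel of
  \<open>blaschke_kernel\<close>.\<close>

lemma crit_poly_nonzero:
  assumes "m \<ge> 1" "set_mset D \<subseteq> ball 0 1"
  shows "crit_poly m D \<noteq> 0" "norm z = 1 \<Longrightarrow> poly (crit_poly m D) z \<noteq> 0"
proof -
  obtain k where k: "\<And>z. norm z \<le> 1 \<Longrightarrow> k z > (0::real)"
    "\<And>z. norm z = 1 \<Longrightarrow> poly (crit_poly m D) z = z ^ size D * of_real (k z)"
    by (rule blaschke_kernel[OF assms]) (rule that; assumption)
  have *: "poly (crit_poly m D) z \<noteq> 0" if "norm z = 1" for z
    using k(1)[of z] k(2)[OF that] that by auto
  show "norm z = 1 \<Longrightarrow> poly (crit_poly m D) z \<noteq> 0" by (rule *)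
  show "crit_poly m D \<noteq> 0" using *[of 1] by auto
qed

text \<open>The quotient \<open>u\<close> of the two pulled back densities is continuous on the
  closed disk once the common factor \<open>1 - (norm z)\<^sup>2\<close> has cancelled. On the
  circle it is 1, by the boundary values of the kernels. A maximum above 1 would lie inside, against
  \<open>no_interior_max\<close>.\<close>

lemma kernel_comparison:
  assumes m: "m \<ge> 1" and D: "set_mset D \<subseteq> ball 0 1" "set_mset D' \<subseteq> ball 0 1" "size D = size D'"
    and t: "crit_poly m D = smult t (crit_poly m D')"
    and z: "norm z < 1"
  shows "norm t * ((norm (poly (pole_poly D') z))\<^sup>2 - (norm (z ^ m * poly (zero_poly D') z))\<^sup>2)
       \<le> (norm (poly (pole_poly D) z))\<^sup>2 - (norm (z ^ m * poly (zero_poly D) z))\<^sup>2"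
proof -
  obtain k where k: "continuous_on UNIV k"
    "\<And>z. (norm (poly (pole_poly D) z))\<^sup>2 - (norm (z ^ m * poly (zero_poly D) z))\<^sup>2 = (1 - (norm z)\<^sup>2) * k z"
    "\<And>z. norm z \<le> 1 \<Longrightarrow> k z > 0"
    "\<And>z. norm z = 1 \<Longrightarrow> poly (crit_poly m D) z = z ^ size D * of_real (k z)"
    by (rule blaschke_kernel[OF m D(1)]) (rule that; assumption)
  obtain k' where k': "continuous_on UNIV k'"
    "\<And>z. (norm (poly (pole_poly D') z))\<^sup>2 - (norm (z ^ m * poly (zero_poly D') z))\<^sup>2 = (1 - (norm z)\<^sup>2) * k' z"
    "\<And>z. norm z \<le> 1 \<Longrightarrow> k' z > 0"
    "\<And>z. norm z = 1 \<Longrightarrow> poly (crit_poly m D') z = z ^ size D' * of_real (k' z)"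
    by (rule blaschke_kernel[OF m D(2)]) (rule that; assumption)
  define u where "u = (\<lambda>z. norm t * k' z / k z)"
  have "continuous_on (cball 0 1) u"
    unfolding u_def using k(3)
    by (intro continuous_intros continuous_on_subset[OF k(1)] continuous_on_subset[OF k'(1)]) (auto simp: less_imp_neq[symmetric])
  then obtain z0 where z0: "norm z0 \<le> 1" "\<And>z. norm z \<le> 1 \<Longrightarrow> u z \<le> u z0"
    using continuous_attains_sup[of "cball (0::complex) 1" u] by auto
  have "u z0 \<le> 1"
  proof (rule ccontr)
    assume gt: "\<not> u z0 \<le> 1"
    have "norm z0 \<noteq> 1"
    proof
      assume "norm z0 = 1"
      then have "norm (poly (crit_poly m D) z0) = k z0" "norm (poly (crit_poly m D') z0) = k' z0"
        using k(3,4)[of z0] k'(3,4)[of z0] by (simp_all add: norm_mult norm_power)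
      then have "k z0 = norm t * k' z0" unfolding t by (simp add: norm_mult)
      then have "u z0 = 1" using k(3)[OF z0(1)] unfolding u_def by (metis divide_self less_irrefl)
      then show False using gt by simp
    qed
    then have z0': "norm z0 < 1" using z0(1) by simp
    define r where "r = 1 - norm z0"
    have r: "r > 0" using z0' by (simp add: r_def)
    have in1: "norm z < 1" if "z \<in> ball z0 r" for z
      using that norm_triangle_ineq2[of z z0] by (simp add: r_def dist_norm norm_minus_commute)
    define f where "f = (\<lambda>z. z ^ m * poly (zero_poly D) z / poly (pole_poly D) z)"
    define g where "g = (\<lambda>z. z ^ m * poly (zero_poly D') z / poly (pole_poly D') z)"
    \<comment> \<open>The quotient of the derivatives of \<open>f\<close> and \<open>g\<close>:
      their numerators are proportional and cancel, so \<open>\<phi>\<close> is holomorphic even at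
      the common critical points.\<close>
    define \<phi> where "\<phi> = (\<lambda>z. t * (poly (pole_poly D') z)\<^sup>2 / (poly (pole_poly D) z)\<^sup>2)"
    have Q: "poly (pole_poly D) z \<noteq> 0" "poly (pole_poly D') z \<noteq> 0" if "norm z < 1" for z
      using poly_pole_poly_nonzero D(1,2) that by (auto simp: less_imp_le)
    have mf: "1 - (norm (f z))\<^sup>2 = (1 - (norm z)\<^sup>2) * k z / (norm (poly (pole_poly D) z))\<^sup>2"
      and mg: "1 - (norm (g z))\<^sup>2 = (1 - (norm z)\<^sup>2) * k' z / (norm (poly (pole_poly D') z))\<^sup>2" if "norm z < 1" for z
      unfolding k(2)[symmetric] k'(2)[symmetric] f_def g_def using Q[OF that]
      by (simp_all add: norm_divide power_divide field_simps)
    have pos: "1 - (norm (f z))\<^sup>2 > 0" "1 - (norm (g z))\<^sup>2 > 0" if "norm z < 1" for z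
      unfolding mf[OF that] mg[OF that] using Q[OF that] k(3)[of z] k'(3)[of z] that by (auto simp: abs_square_less_1)
    have ueq: "norm (\<phi> z) * (1 - (norm (g z))\<^sup>2) / (1 - (norm (f z))\<^sup>2) = u z" if z: "norm z < 1" for z
    proof -
      have "T * a / b * (s * x / a) / (s * y / b) = T * x / y" if "a \<noteq> 0" "b \<noteq> 0" "s \<noteq> 0" for T a b s x y :: real
        using that by simp
      moreover have "1 - (norm z)\<^sup>2 \<noteq> 0" using z abs_square_less_1[of "norm z"] by simp
      ultimately show ?thesis
        unfolding mf[OF z] mg[OF z] u_def \<phi>_def using Q[OF z] by (simp add: norm_mult norm_divide norm_power)
    qed
    have Df: "(f has_field_derivative z ^ (m - 1) * poly (crit_poly m D) z / (poly (pole_poly D) z)\<^sup>2) (at z)"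
      and Dg: "(g has_field_derivative z ^ (m - 1) * poly (crit_poly m D') z / (poly (pole_poly D') z)\<^sup>2) (at z)"
      if "norm z < 1" for z
      unfolding f_def g_def using has_field_derivative_blaschke m Q[OF that] by blast+
    show False
    proof (rule no_interior_max[OF r, of f _ g \<phi>])
      show "f holomorphic_on ball z0 r" "g holomorphic_on ball z0 r" "\<phi> holomorphic_on ball z0 r"
        unfolding f_def g_def \<phi>_def using Q[OF in1] by (auto intro!: holomorphic_intros)
      show "deriv f z = \<phi> z * deriv g z" if "z \<in> ball z0 r" for z
        unfolding DERIV_imp_deriv[OF Df[OF in1[OF that]]] DERIV_imp_deriv[OF Dg[OF in1[OF that]]] \<phi>_def t
        using Q[OF in1[OF that]] by simp
      show "norm (f z) < 1" "norm (g z) < 1" if "z \<in> ball z0 r" for z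
        using pos[OF in1[OF that]] by (simp_all add: abs_square_less_1)
      show "norm (\<phi> z0) * (1 - (norm (g z0))\<^sup>2) > 1 - (norm (f z0))\<^sup>2"
        using gt pos[OF z0'] unfolding ueq[OF z0', symmetric] by (simp add: field_simps)
      show "norm (\<phi> z) * (1 - (norm (g z))\<^sup>2) / (1 - (norm (f z))\<^sup>2) \<le>
          norm (\<phi> z0) * (1 - (norm (g z0))\<^sup>2) / (1 - (norm (f z0))\<^sup>2)" if "z \<in> ball z0 r" for z
        unfolding ueq[OF z0'] ueq[OF in1[OF that]] using z0(2) in1[OF that] by simp
      show "\<exists>z\<in>ball z0 r. g z \<noteq> g z0"
      proof (rule ccontr)
        assume "\<not> ?thesis"
        then have const: "\<And>z. z \<in> ball z0 r \<Longrightarrow> g z = g z0" by blast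
        \<comment> \<open>If \<open>g\<close> were constant near \<open>z0\<close>, the numerator of
          its derivative, a nonzero polynomial, would vanish on a disk.\<close>
        have "poly ([:0, 1:] ^ (m - 1) * crit_poly m D') z = 0" if "z \<in> ball z0 r" for z
        proof -
          have "((\<lambda>_. g z0) has_field_derivative z ^ (m - 1) * poly (crit_poly m D') z / (poly (pole_poly D') z)\<^sup>2) (at z)"
            by (rule has_field_derivative_transform_within_open[OF Dg[OF in1[OF that]] open_ball that const])
          then have "z ^ (m - 1) * poly (crit_poly m D') z / (poly (pole_poly D') z)\<^sup>2 = 0"
            using DERIV_unique DERIV_const by blast
          then show ?thesis using Q[OF in1[OF that]] by (simp add: poly_power)
        qed
        then have "ball z0 r \<subseteq> {z. poly ([:0, 1:] ^ (m - 1) * crit_poly m D') z = 0}" by blast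
        moreover have "[:0, 1:] ^ (m - 1) * crit_poly m D' \<noteq> 0"
          using crit_poly_nonzero[OF m D(2)] by simp
        ultimately have "finite (ball z0 r)" using poly_roots_finite finite_subset by metis
        then show False using uncountable_ball[of r z0] r countable_finite by auto
      qed
    qed
  qed
  then have "u z \<le> 1" using z0(2)[of z] z by simp
  then have "norm t * k' z \<le> k z" using k(3)[of z] z by (simp add: u_def field_simps)
  moreover have "1 - (norm z)\<^sup>2 > 0" using z by (simp add: abs_square_less_1)
  ultimately show ?thesis unfolding k(2) k'(2) by (simp add: mult.left_commute)
qed

text \<open>The comparison applies in both directions, with factors \<open>t\<close> and
  \<open>1 / t\<close>, and gives an equality of kernels. Polarization then separates the pole
  polynomials from the zero polynomials.\<close>

proposition crit_poly_inj:
  assumes m: "m \<ge> 1" and D: "set_mset D \<subseteq> ball 0 1" "set_mset D' \<subseteq> ball 0 1" "size D = size D'"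
    and t: "crit_poly m D = smult t (crit_poly m D')"
  shows "D = D'"
proof -
  let ?P = "zero_poly D" and ?P' = "zero_poly D'" and ?Q = "pole_poly D" and ?Q' = "pole_poly D'"
  define A A' where "A = [:0, 1:] ^ m * ?P" and "A' = [:0, 1:] ^ m * ?P'"
  have A: "poly A z = z ^ m * poly ?P z" "poly A' z = z ^ m * poly ?P' z" for z
    by (simp_all add: A_def A'_def poly_power)
  have t0: "t \<noteq> 0" using t crit_poly_nonzero[OF m D(1)] by auto
  then have t': "crit_poly m D' = smult (1 / t) (crit_poly m D)" using t by simp
  have eq: "(norm (poly ?Q z))\<^sup>2 - (norm (poly A z))\<^sup>2 = norm t * ((norm (poly ?Q' z))\<^sup>2 - (norm (poly A' z))\<^sup>2)"
    if z: "norm z < 1" for z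
    using kernel_comparison[OF m D t z] kernel_comparison[OF m D(2,1) D(3)[symmetric] t' z] t0
    unfolding A by (simp add: norm_divide field_simps)
  let ?c = "map_poly cnj" and ?s = "complex_of_real (norm t)"
  have pol: "poly ?Q z * poly (?c ?Q) w - poly A z * poly (?c A) w
      = ?s * (poly ?Q' z * poly (?c ?Q') w - poly A' z * poly (?c A') w)" for z w
  proof -
    \<comment> \<open>The four pairs are the terms of \<open>eq\<close> moved to one side;
      \<open>map_poly cnj\<close> expresses a conjugate value as a polynomial in
      \<open>cnj z\<close>.\<close>
    have "(\<Sum>(a, b)\<leftarrow>[(?Q, ?c ?Q), (- A, ?c A), (smult (- ?s) ?Q', ?c ?Q'), (smult ?s A', ?c A')]. poly a z * poly b w) = 0"
    proof (rule polarization[of 1])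
      fix z :: complex assume "norm z < 1"
      from arg_cong[OF eq[OF this], of complex_of_real]
      show "(\<Sum>(a, b)\<leftarrow>[(?Q, ?c ?Q), (- A, ?c A), (smult (- ?s) ?Q', ?c ?Q'), (smult ?s A', ?c A')]. poly a z * poly b (cnj z)) = 0"
        unfolding of_real_diff of_real_mult complex_norm_square by (simp add: algebra_simps)
    qed simp
    then show ?thesis by (simp add: algebra_simps)
  qed
  have Q0: "poly (pole_poly E) 0 = 1" for E by (simp add: poly_pole_poly)
  have A0: "poly A 0 = 0" "poly A' 0 = 0" using m by (simp_all add: A)
  \<comment> \<open>At \<open>w = 0\<close> the terms with \<open>A\<close> and \<open>A'\<close>
    drop out, since \<open>m \<ge> 1\<close>, and the conjugated pole polynomials are 1. Evaluation
    at 0 then gives \<open>norm t = 1\<close>.\<close>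
  have Qs: "poly ?Q z = ?s * poly ?Q' z" for z
    using pol[of z 0] by (simp add: Q0 A0)
  then have "?s = 1" using Q0 by (metis mult.right_neutral)
  then have Qeq: "poly ?Q z = poly ?Q' z" for z using Qs by simp
  have "?P = ?P'"
  proof (rule poly_eq_if_nonzero_eq)
    fix z :: complex assume "z \<noteq> 0"
    then show "poly ?P z = poly ?P' z"
      using poly_zero_poly_reflect[of z D] poly_zero_poly_reflect[of z D'] Qeq D(3) by simp
  qed
  then show ?thesis by (rule zero_poly_inj)
qed

section \<open>The free ramification divisor\<close>

text \<open>Induction on \<open>n\<close>: roots come in pairs \<open>c\<close> and
  \<open>1 / cnj c\<close>, and none lies on the circle, so some root is inside the disk. Its pair
  splits off as \<open>(z - c) * (1 - cnj c * z)\<close>, which has the same symmetry with formal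
  degree 2.\<close>

lemma reflexive_poly_factorization:
  fixes F :: "complex poly"
  assumes "F \<noteq> 0" "\<And>z. z \<noteq> 0 \<Longrightarrow> z ^ (2 * n) * cnj (poly F (1 / cnj z)) = poly F z"
    "\<And>z. norm z = 1 \<Longrightarrow> poly F z \<noteq> 0"
  shows "\<exists>C c. set_mset C \<subseteq> ball 0 1 \<and> size C = n \<and> c \<noteq> 0 \<and> F = smult c (zero_poly C * pole_poly C)"
  using assms
proof (induction n arbitrary: F)
  case 0
  have "degree F = 0"
  proof (rule ccontr)
    assume deg: "degree F \<noteq> 0"
    obtain a p where F: "F = pCons a p" by (cases F)
    with deg have "p \<noteq> 0" by auto
    \<comment> \<open>A nonconstant polynomial is unbounded, whereas the symmetry carries the bound
      on the closed disk over to its exterior.\<close>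
    have "compact (poly F ` cball 0 1)" by (intro compact_continuous_image continuous_intros compact_cball)
    then obtain M where M: "\<And>z. norm z \<le> 1 \<Longrightarrow> norm (poly F z) \<le> M"
      by (metis bounded_iff compact_imp_bounded imageI mem_cball_0)
    obtain r where r: "\<And>z. r \<le> norm z \<Longrightarrow> M + 1 \<le> norm (poly F z)"
      using poly_infinity[OF \<open>p \<noteq> 0\<close>, of "M + 1" a] F by blast
    define z where "z = complex_of_real (max r 1)"
    have z: "norm z \<ge> r" "norm z \<ge> 1" by (simp_all add: z_def)
    then have "z \<noteq> 0" by auto
    then have "cnj (poly F (1 / cnj z)) = poly F z" using 0(2)[of z] by simp
    then have "norm (poly F z) = norm (poly F (1 / cnj z))" by (metis complex_mod_cnj)
    moreover have "norm (1 / cnj z) \<le> 1" using z by (simp add: norm_divide divide_le_eq)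
    ultimately show False using M r[OF z(1)] by fastforce
  qed
  then obtain c where "F = [:c:]" using degree_eq_zeroE by blast
  then show ?case using 0(1) by (intro exI[of _ "{#}"] exI[of _ c]) auto
next
  case (Suc n)
  have "degree F > 0"
  proof (rule ccontr)
    assume "\<not> degree F > 0"
    then obtain c where F: "F = [:c:]" using degree_eq_zeroE by blast
    \<comment> \<open>The formal degree is positive here, so the symmetry at \<open>z = 2\<close>
      excludes a nonzero constant.\<close>
    have "2 ^ (2 * Suc n) * cnj c = c" using Suc.prems(2)[of 2] F by simp
    then have "norm ((2::complex) ^ (2 * Suc n)) * norm c = norm c" by (metis complex_mod_cnj norm_mult)
    moreover have "c \<noteq> 0" using F Suc.prems(1) by auto
    ultimately have "(2::real) ^ (2 * Suc n) = 1" by (simp add: norm_power)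
    moreover have "1 < (2::real) ^ (2 * Suc n)" by (rule one_less_power) auto
    ultimately show False by simp
  qed
  then obtain c0 where c0: "poly F c0 = 0" using alg_closed_imp_poly_has_root by blast
  obtain c where c: "norm c < 1" "poly F c = 0"
  proof (cases "norm c0 < 1")
    case True then show ?thesis using that c0 by blast
  next
    case False
    then have "norm c0 > 1" using Suc.prems(3)[of c0] c0 by (metis linorder_neqE_linordered_idom)
    moreover from this have "c0 \<noteq> 0" by auto
    ultimately show ?thesis using that[of "1 / cnj c0"] Suc.prems(2)[of c0] c0 by (simp add: norm_divide)
  qed
  obtain F1 where F1: "F = [:- c, 1:] * F1" using c(2) by (metis dvdE poly_eq_0_iff_dvd)
  \<comment> \<open>A root at 0 is paired with infinity and its second factor is 1; for other roots
    the reflected root is distinct and survives the division by the first factor.\<close>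
  obtain F2 where F2: "F1 = [:1, - cnj c:] * F2"
  proof (cases "c = 0")
    case True then show ?thesis using that[of F1] by simp
  next
    case False
    then have c': "1 / cnj c \<noteq> 0" by simp
    have "poly F (1 / cnj c) = 0" using Suc.prems(2)[OF c'] c by simp
    then have "(1 / cnj c - c) * poly F1 (1 / cnj c) = 0" unfolding F1 by (simp add: algebra_simps)
    moreover have "1 / cnj c - c \<noteq> 0"
    proof
      assume "1 / cnj c - c = 0"
      then have "norm (1 / cnj c) = norm c" by simp
      moreover have "norm (1 / cnj c) > 1" using c(1) False by (simp add: norm_divide)
      ultimately show False using c(1) by simp
    qed
    ultimately have "poly F1 (1 / cnj c) = 0" unfolding mult_eq_0_iff by blast
    then obtain p where "F1 = [:- (1 / cnj c), 1:] * p" by (metis dvdE poly_eq_0_iff_dvd)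
    also have "[:- (1 / cnj c), 1:] = [:1, - cnj c:] * [:- (1 / cnj c):]" using False by simp
    finally show ?thesis using that by (metis mult.assoc)
  qed
  define q where "q = [:- c, 1:] * [:1, - cnj c:]"
  have F: "F = q * F2" unfolding F1 F2 q_def by (simp only: mult.assoc)
  have qz: "poly q z = (z - c) * (1 - cnj c * z)" for z by (simp add: q_def algebra_simps)
  have qr: "z\<^sup>2 * cnj (poly q (1 / cnj z)) = poly q z" if "z \<noteq> 0" for z
    unfolding qz using that by (simp add: field_simps power2_eq_square)
  have "F2 \<noteq> 0" using F Suc.prems(1) by auto
  moreover have "z ^ (2 * n) * cnj (poly F2 (1 / cnj z)) = poly F2 z" if z: "z \<noteq> 0" for z
  proof (rule ccontr)
    \<comment> \<open>Cancelling \<open>q\<close> proves the symmetry of \<open>F2\<close> only off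
      the roots of \<open>q\<close>. A nonzero value of \<open>h\<close> would persist on a disk by
      continuity and force \<open>q * [:0, 1:]\<close> to vanish there.\<close>
    define h where "h = (\<lambda>z. z ^ (2 * n) * cnj (poly F2 (1 / cnj z)) - poly F2 z)"
    assume "\<not> ?thesis"
    then have "h z \<noteq> 0" by (simp add: h_def)
    moreover have "continuous (at z) h" unfolding h_def using z by (intro continuous_intros) auto
    ultimately obtain d where d: "d > 0" "\<And>y. dist z y < d \<Longrightarrow> h y \<noteq> 0"
      using continuous_at_avoid by blast
    have "poly (q * [:0, 1:]) y = 0" if "y \<in> ball z d" for y
    proof (cases "y = 0")
      case False
      have "poly q y * h y = (y\<^sup>2 * cnj (poly q (1 / cnj y))) * (y ^ (2 * n) * cnj (poly F2 (1 / cnj y))) - poly q y * poly F2 y"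
        unfolding qr[OF False] h_def by (simp add: algebra_simps)
      also have "\<dots> = 0" using Suc.prems(2)[OF False] unfolding F by (simp add: power2_eq_square mult_ac)
      finally show ?thesis using d(2) that by simp
    qed simp
    then have "ball z d \<subseteq> {y. poly (q * [:0, 1:]) y = 0}" by blast
    moreover have "q * [:0, 1:] \<noteq> 0" using F Suc.prems(1) by auto
    ultimately have "finite (ball z d)" using poly_roots_finite finite_subset by metis
    then show False using uncountable_ball[of d z] d countable_finite by auto
  qed
  moreover have "poly F2 z \<noteq> 0" if "norm z = 1" for z using Suc.prems(3)[OF that] unfolding F by auto
  ultimately obtain C b where C: "set_mset C \<subseteq> ball 0 1" "size C = n" "b \<noteq> 0" "F2 = smult b (zero_poly C * pole_poly C)"
    using Suc.IH by blast
  have "F = smult b (zero_poly (add_mset c C) * pole_poly (add_mset c C))"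
    unfolding F C(4) q_def zero_poly_add_mset pole_poly_add_mset by (simp only: mult_smult_right mult_ac)
  then show ?case using C c by (intro exI[of _ "add_mset c C"] exI[of _ b]) auto
qed

section \<open>Local degrees and ramification of Blaschke products\<close>

lemma local_degree_eq:
  assumes S: "open S" "q \<in> S" and f: "f holomorphic_on S" and h: "h holomorphic_on S" "h q \<noteq> 0"
    and deriv: "\<And>z. z \<in> S \<Longrightarrow> deriv f z = (z - q) ^ j * h z"
  shows "local_degree f q = Suc j"
proof -
  let ?F = "\<lambda>z. f z - f q"
  have F: "?F holomorphic_on S" using f by (intro holomorphic_intros)
  have an: "?F analytic_on {q}" using F S analytic_at by blast
  have dF: "deriv ?F z = deriv f z" if "z \<in> S" for z
    using f S that by (intro DERIV_imp_deriv) (auto intro!: derivative_eq_intros holomorphic_derivI)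
  \<comment> \<open>If \<open>f\<close> were constant near \<open>q\<close>, its derivative and
    hence \<open>h\<close> would vanish at nearby points other than \<open>q\<close>, and by
    continuity \<open>h q = 0\<close>.\<close>
  have fr: "\<exists>\<^sub>F w in at q. ?F w \<noteq> 0"
  proof (rule ccontr)
    assume "\<not> ?thesis"
    then have "\<forall>\<^sub>F w in at q. ?F w = 0" by (simp add: frequently_def)
    then obtain T where T: "open T" "q \<in> T" "\<And>w. w \<in> T \<Longrightarrow> w \<noteq> q \<Longrightarrow> ?F w = 0"
      unfolding eventually_at_topological by auto
    then have T0: "\<And>w. w \<in> T \<Longrightarrow> f w = f q" by force
    have "h w = 0" if w: "w \<in> T \<inter> S - {q}" for w
    proof -
      have "(f has_field_derivative 0) (at w)"
        using has_field_derivative_transform_within_open[OF DERIV_const T(1)] T0 w by (metis DiffD1 IntD1)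
      from DERIV_imp_deriv[OF this] show ?thesis using deriv[of w] w by simp
    qed
    then have "\<forall>\<^sub>F w in at q. h w = 0"
      unfolding eventually_at_topological using T S by (intro exI[of _ "T \<inter> S"]) auto
    moreover have "(h \<longlongrightarrow> h q) (at q)"
      using h(1) S by (metis continuous_on_eq_continuous_at holomorphic_on_imp_continuous_on isCont_def)
    ultimately have "h q = 0" by (metis tendsto_eventually tendsto_unique at_neq_bot)
    then show False using h(2) by simp
  qed
  have "zorder ?F q > 0" using zorder_pos_iff'[OF an fr] by simp
  then have "zorder (deriv ?F) q = zorder ?F q - 1"
    by (intro zorder_deriv_minus_1 isolated_singularity_at_analytic not_essential_analytic an fr) simp
  moreover have "zorder (deriv ?F) q = int j"
    by (rule zorder_eqI[OF S h]) (simp add: dF deriv mult.commute)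
  ultimately show ?thesis by (simp add: local_degree_def)
qed

text \<open>In the disk \<open>Q\<close> has no zeros, so the derivative of the Blaschke product
  vanishes to the order of \<open>z ^ (m - 1) * crit_poly m D\<close>. There
  \<open>pole_poly C\<close> has no zeros either, which leaves the multiplicities of
  \<open>M\<close>.\<close>

lemma free_ramification_blaschke:
  assumes m: "m \<ge> 1" and a: "\<forall>k<e. a k \<in> ball 0 1" and C: "set_mset C \<subseteq> ball 0 1" "c \<noteq> 0"
    and crit: "crit_poly m (tuple_divisor e a) = smult c (zero_poly C * pole_poly C)"
  shows "free_ramification m (blaschke e m a) = C"
proof -
  define D where "D = tuple_divisor e a"
  let ?f = "blaschke e m a" and ?Q = "pole_poly D"
  have D: "set_mset D \<subseteq> ball 0 1" using a tuple_divisor_in_Div[of e a "ball 0 1"] by (simp add: D_def Div_def)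
  define b where "b = (\<Prod>k<e. (1 - cnj (a k)) / (1 - a k))"
  have b: "b \<noteq> 0"
    using a by (auto simp: b_def complex_cnj_one_iff)
  have f: "?f z = b * (z ^ m * poly (zero_poly D) z / poly ?Q z)" for z
    unfolding blaschke_def b_def D_def poly_zero_poly poly_pole_poly tuple_divisor_image
    by (simp add: multiset.map_comp o_def prod.distrib prod_dividef flip: prod_unfold_prod_mset)
  define R where "R = [:0, 1:] ^ (m - 1) * crit_poly m D"
  have R0: "R \<noteq> 0" using crit_poly_nonzero[OF m D] by (simp add: R_def)
  have Q: "poly ?Q z \<noteq> 0" if "z \<in> ball 0 1" for z
    using poly_pole_poly_nonzero[OF D] that by (simp add: less_imp_le)
  have df: "(?f has_field_derivative b * (poly R z / (poly ?Q z)\<^sup>2)) (at z)" if "z \<in> ball 0 1" for z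
    using DERIV_cmult[OF has_field_derivative_blaschke[OF m Q[OF that]], of b]
    unfolding f[abs_def] R_def by (simp add: poly_power)
  define M where "M = replicate_mset (m - 1) 0 + C"
  have ord: "order q R = count M q" if "q \<in> ball 0 1" for q
  proof -
    have "set_mset C \<subseteq> cball 0 1" using C(1) ball_subset_cball by blast
    then have "order q (pole_poly C) = 0" using order_pole_poly_ball that by simp
    moreover have "order q ([:0, 1:] ^ (m - 1)) = count (replicate_mset (m - 1) (0::complex)) q"
      using order_zero_poly[of q "replicate_mset (m - 1) 0"] by (simp add: zero_poly_def prod_mset_replicate_mset)
    moreover have "[:0, 1:] ^ (m - 1) * (zero_poly C * pole_poly C) \<noteq> 0" by simp
    ultimately show ?thesis
      using C(2) by (simp add: R_def M_def crit D_def order_smult order_mult order_zero_poly)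
  qed
  have ld: "local_degree ?f q = Suc (count M q)" if q: "q \<in> ball 0 1" for q
  proof -
    obtain p where p: "R = [:- q, 1:] ^ order q R * p" "\<not> [:- q, 1:] dvd p"
      using order_decomp[OF R0, of q] by blast
    have "poly p q \<noteq> 0" using p(2) by (simp add: poly_eq_0_iff_dvd)
    show ?thesis
    proof (rule local_degree_eq[of "ball 0 1" q ?f "\<lambda>z. b * (poly p z / (poly ?Q z)\<^sup>2)"])
      show "?f holomorphic_on ball 0 1" unfolding f[abs_def] using Q by (auto intro!: holomorphic_intros)
      show "(\<lambda>z. b * (poly p z / (poly ?Q z)\<^sup>2)) holomorphic_on ball 0 1" using Q by (auto intro!: holomorphic_intros)
      show "b * (poly p q / (poly ?Q q)\<^sup>2) \<noteq> 0" using b \<open>poly p q \<noteq> 0\<close> Q[OF q] by simp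
      show "deriv ?f z = (z - q) ^ count M q * (b * (poly p z / (poly ?Q z)\<^sup>2))" if "z \<in> ball 0 1" for z
        unfolding DERIV_imp_deriv[OF df[OF that]] by (subst p(1)) (simp add: ord[OF q] poly_power)
    qed (use q in auto)
  qed
  have M: "set_mset M \<subseteq> ball 0 1" using C(1) by (auto simp: M_def)
  have set: "{q. q \<in> ball 0 1 \<and> local_degree ?f q > 1} = set_mset M"
    using M by (auto simp: ld simp del: mem_ball)
  have "ramification_divisor ?f = (\<Sum>q\<in>set_mset M. replicate_mset (count M q) q)"
    unfolding ramification_divisor_def set using M by (intro sum.cong refl) (auto simp: ld simp del: mem_ball)
  also have "\<dots> = M"
    by (rule multiset_eqI) (auto simp: count_sum if_distrib sum.delta not_in_iff cong: if_cong)
  finally show ?thesis by (simp add: free_ramification_def M_def)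
qed

text \<open>Replaces \<open>Psi\<close> by an algebraic relation between divisors: the factorization
  of the critical polynomial supplies \<open>C\<close>, and
  \<open>free_ramification_blaschke\<close> identifies \<open>C\<close> as the free ramification
  divisor.\<close>

proposition Psi_properties:
  assumes m: "m \<ge> 1" and D: "D \<in> Div e (ball 0 1)"
  obtains c where "Psi e m D \<in> Div e (ball 0 1)" "c \<noteq> 0"
    "crit_poly m D = smult c (zero_poly (Psi e m D) * pole_poly (Psi e m D))"
proof -
  have D': "set_mset D \<subseteq> ball 0 1" "size D = e" using D by (auto simp: Div_def)
  obtain a where a: "a \<in> {..<e} \<rightarrow>\<^sub>E ball 0 1" "tuple_divisor e a = D" using D by (rule Div_tupleE)
  then have a': "\<forall>k<e. a k \<in> ball 0 1" by (auto simp: PiE_iff)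
  have "\<exists>C c. set_mset C \<subseteq> ball 0 1 \<and> size C = e \<and> c \<noteq> 0 \<and> crit_poly m D = smult c (zero_poly C * pole_poly C)"
    using crit_poly_reflect[of _ D m] D' crit_poly_nonzero[OF m D'(1)] by (intro reflexive_poly_factorization) auto
  then obtain C c where C: "set_mset C \<subseteq> ball 0 1" "size C = e" "c \<noteq> 0" "crit_poly m D = smult c (zero_poly C * pole_poly C)"
    by blast
  have "blaschke e m a \<in> blaschke_space e m" using a' by (auto simp: blaschke_space_def)
  then have "Psi e m D = free_ramification m (blaschke e m a)"
    using Psi_free_zeros free_zeros_blaschke[OF a'] a(2) by metis
  also have "\<dots> = C" by (rule free_ramification_blaschke[OF m a' C(1,3)]) (simp add: a C)
  finally show ?thesis using that C by (auto simp: Div_def)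
qed

section \<open>The extension to the closed disk\<close>

text \<open>The filters give the splitting without a choice of summands; for a divisor on the closed
  disk the second one collects the circle points.\<close>

definition Psi_ext :: "nat \<Rightarrow> complex multiset \<Rightarrow> complex multiset" where
  "Psi_ext m D = Psi (size {#q \<in># D. q \<in> ball 0 1#}) m {#q \<in># D. q \<in> ball 0 1#} + {#q \<in># D. q \<notin> ball 0 1#}"

lemma filter_mset_union_split:
  assumes "set_mset A \<subseteq> S" "set_mset B \<inter> S = {}"
  shows "{#q \<in># A + B. q \<in> S#} = A" "{#q \<in># A + B. q \<notin> S#} = B"
proof -
  have "{#q \<in># A. q \<in> S#} = A" "{#q \<in># A. q \<notin> S#} = {#}" "{#q \<in># B. q \<in> S#} = {#}" "{#q \<in># B. q \<notin> S#} = B"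
    using assms by (auto simp: filter_mset_eq_conv)
  then show "{#q \<in># A + B. q \<in> S#} = A" "{#q \<in># A + B. q \<notin> S#} = B" by simp_all
qed

lemma filter_ball_union:
  assumes "A \<in> Div a (ball 0 1)" "B \<in> Div b (sphere 0 1)"
  shows "{#q \<in># A + B. q \<in> ball 0 1#} = A" "{#q \<in># A + B. q \<notin> ball 0 1#} = B"
  using assms by (intro filter_mset_union_split; force simp: Div_def)+

lemma Psi_ext_union:
  assumes "D1 \<in> Div d1 (ball 0 1)" "D2 \<in> Div d2 (sphere 0 1)"
  shows "Psi_ext m (D1 + D2) = Psi d1 m D1 + D2"
  using assms(1) unfolding Psi_ext_def filter_ball_union[OF assms] by (simp add: Div_def)

lemma Psi_ext_ball: "D \<in> Div e (ball 0 1) \<Longrightarrow> Psi_ext m D = Psi e m D"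
  using Psi_ext_union[of D e "{#}" 0] by (simp add: Div_def)

lemma Div_cballE:
  assumes "D \<in> Div e (cball 0 1)"
  obtains d1 d2 D1 D2 where "D = D1 + D2" "d1 + d2 = e" "D1 \<in> Div d1 (ball 0 1)" "D2 \<in> Div d2 (sphere 0 1)"
proof -
  define D1 D2 where "D1 = {#q \<in># D. q \<in> ball 0 1#}" and "D2 = {#q \<in># D. q \<notin> ball 0 1#}"
  have D: "D = D1 + D2" unfolding D1_def D2_def by (rule multiset_partition)
  have "set_mset D \<subseteq> cball 0 1" "size D = e" using assms by (auto simp: Div_def)
  then have "D1 \<in> Div (size D1) (ball 0 1)" "D2 \<in> Div (size D2) (sphere 0 1)"
    by (auto simp: Div_def D1_def D2_def subset_iff)
  moreover have "size D1 + size D2 = e" using \<open>size D = e\<close> D by simp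
  ultimately show ?thesis using that D by blast
qed

lemma Div_union:
  assumes "D1 \<in> Div d1 (ball 0 1)" "D2 \<in> Div d2 (sphere 0 1)"
  shows "D1 + D2 \<in> Div (d1 + d2) (cball 0 1)"
  using assms by (auto simp: Div_def subset_iff less_imp_le)

text \<open>A circle point contributes the same factor to \<open>crit_poly\<close> and to the
  product on the right, so one proportionality covers interior and boundary divisors.\<close>

lemma Psi_ext_properties:
  assumes m: "m \<ge> 1" and D: "D \<in> Div e (cball 0 1)"
  obtains c where "Psi_ext m D \<in> Div e (cball 0 1)" "c \<noteq> 0"
    "crit_poly m D = smult c (zero_poly (Psi_ext m D) * pole_poly (Psi_ext m D))"
proof -
  obtain d1 d2 D1 D2 where *: "D = D1 + D2" "d1 + d2 = e" "D1 \<in> Div d1 (ball 0 1)" "D2 \<in> Div d2 (sphere 0 1)"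
    using D by (rule Div_cballE)
  obtain c where c: "Psi d1 m D1 \<in> Div d1 (ball 0 1)" "c \<noteq> 0"
    "crit_poly m D1 = smult c (zero_poly (Psi d1 m D1) * pole_poly (Psi d1 m D1))"
    using Psi_properties[OF m *(3)] by metis
  have eq: "Psi_ext m D = Psi d1 m D1 + D2" using Psi_ext_union * by simp
  have "set_mset D2 \<subseteq> sphere 0 1" using *(4) by (simp add: Div_def)
  then have "crit_poly m D = smult c (zero_poly (Psi_ext m D) * pole_poly (Psi_ext m D))"
    unfolding *(1) eq[unfolded *(1)] by (simp add: crit_poly_union_sphere c(3) zero_poly_union pole_poly_union mult_ac)
  then show ?thesis using that c(2) Div_union[OF c(1) *(4)] *(2) eq by auto
qed

lemma Psi_ext_in_Div: "m \<ge> 1 \<Longrightarrow> D \<in> Div e (cball 0 1) \<Longrightarrow> Psi_ext m D \<in> Div e (cball 0 1)"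
  by (rule Psi_ext_properties)

text \<open>\<open>Psi\<close> keeps the inner part in the open disk, so both parts can be read off
  the value. Equal inner parts make the critical polynomials proportional, and
  \<open>crit_poly_inj\<close> applies.\<close>

lemma Psi_ext_inj:
  assumes m: "m \<ge> 1"
  shows "inj_on (Psi_ext m) (Div e (cball 0 1))"
proof (rule inj_onI)
  fix D D' assume D: "D \<in> Div e (cball 0 1)" and D': "D' \<in> Div e (cball 0 1)" and eq: "Psi_ext m D = Psi_ext m D'"
  obtain d1 d2 D1 D2 where *: "D = D1 + D2" "d1 + d2 = e" "D1 \<in> Div d1 (ball 0 1)" "D2 \<in> Div d2 (sphere 0 1)"
    using D by (rule Div_cballE)
  obtain d1' d2' D1' D2' where **: "D' = D1' + D2'" "d1' + d2' = e" "D1' \<in> Div d1' (ball 0 1)" "D2' \<in> Div d2' (sphere 0 1)"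
    using D' by (rule Div_cballE)
  obtain c where c: "Psi d1 m D1 \<in> Div d1 (ball 0 1)" "c \<noteq> 0"
    "crit_poly m D1 = smult c (zero_poly (Psi d1 m D1) * pole_poly (Psi d1 m D1))"
    using Psi_properties[OF m *(3)] by metis
  obtain c' where c': "Psi d1' m D1' \<in> Div d1' (ball 0 1)" "c' \<noteq> 0"
    "crit_poly m D1' = smult c' (zero_poly (Psi d1' m D1') * pole_poly (Psi d1' m D1'))"
    using Psi_properties[OF m **(3)] by metis
  have eq2: "Psi d1 m D1 + D2 = Psi d1' m D1' + D2'"
    using eq Psi_ext_union *(1,3,4) **(1,3,4) by simp
  have P: "Psi d1 m D1 = Psi d1' m D1'"
    using filter_ball_union(1)[OF c(1) *(4)] filter_ball_union(1)[OF c'(1) **(4)] eq2 by (simp del: mem_ball)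
  have D2: "D2 = D2'"
    using filter_ball_union(2)[OF c(1) *(4)] filter_ball_union(2)[OF c'(1) **(4)] eq2 by (simp del: mem_ball)
  have "size D1 = size D1'" using P c(1) c'(1) *(3) **(3) by (simp add: Div_def)
  moreover have "crit_poly m D1 = smult (c / c') (crit_poly m D1')"
    unfolding c(3) c'(3) P using c'(2) by simp
  moreover have "set_mset D1 \<subseteq> ball 0 1" "set_mset D1' \<subseteq> ball 0 1" using *(3) **(3) by (simp_all add: Div_def)
  ultimately have "D1 = D1'" using crit_poly_inj[OF m] by blast
  then show "D = D'" using D2 * ** by simp
qed

section \<open>Continuity of the extension\<close>

lemma continuous_map_mult_complex:
  fixes f :: "'a \<Rightarrow> complex"
  shows "\<lbrakk>continuous_map X euclidean f; continuous_map X euclidean g\<rbrakk> \<Longrightarrow> continuous_map X euclidean (\<lambda>x. f x * g x)"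
  by (simp add: continuous_map_atin tendsto_mult)

lemma continuous_map_cnj:
  "continuous_map X euclidean f \<Longrightarrow> continuous_map X euclidean (\<lambda>x. cnj (f x))"
  by (simp add: continuous_map_atin tendsto_cnj)

lemma continuous_map_coeff_mult:
  fixes p q :: "'a \<Rightarrow> complex poly"
  assumes "\<And>i. continuous_map X euclidean (\<lambda>x. coeff (p x) i)" "\<And>i. continuous_map X euclidean (\<lambda>x. coeff (q x) i)"
  shows "continuous_map X euclidean (\<lambda>x. coeff (p x * q x) i)"
  unfolding coeff_mult by (intro continuous_map_sum continuous_map_mult_complex assms) auto

lemma continuous_map_coeff_prod:
  fixes p :: "'b \<Rightarrow> 'a \<Rightarrow> complex poly"
  assumes "\<And>k i. k \<in> I \<Longrightarrow> continuous_map X euclidean (\<lambda>x. coeff (p k x) i)"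
  shows "continuous_map X euclidean (\<lambda>x. coeff (\<Prod>k\<in>I. p k x) i)"
  using assms
proof (induction I arbitrary: i rule: infinite_finite_induct)
  case (insert k I)
  then show ?case by (simp add: continuous_map_coeff_mult)
qed auto

lemma continuous_map_coeff_linear:
  fixes f g :: "'a \<Rightarrow> complex"
  assumes "continuous_map X euclidean f" "continuous_map X euclidean g"
  shows "continuous_map X euclidean (\<lambda>x. coeff [:f x, g x:] i)"
proof (cases i)
  case (Suc j)
  then show ?thesis using assms by (cases j) simp_all
qed (use assms in simp)

lemma continuous_map_coordinate:
  "k < e \<Longrightarrow> continuous_map (power_topology e \<Omega>) euclidean (\<lambda>a. a k)"
  unfolding power_topology_def
  by (rule continuous_map_into_fulltopology[of _ _ \<Omega>]) (use continuous_map_product_projection[of k "{..<e}" "\<lambda>_. top_of_set \<Omega>"] in auto)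

lemma continuous_map_coeff_tuple:
  shows continuous_map_coeff_zero_poly:
      "continuous_map (power_topology e \<Omega>) euclidean (\<lambda>a. coeff (zero_poly (tuple_divisor e a)) i)"
    and continuous_map_coeff_pole_poly:
      "continuous_map (power_topology e \<Omega>) euclidean (\<lambda>a. coeff (pole_poly (tuple_divisor e a)) i)"
    and continuous_map_coeff_crit_poly:
      "continuous_map (power_topology e \<Omega>) euclidean (\<lambda>a. coeff (crit_poly m (tuple_divisor e a)) i)"
proof -
  let ?X = "power_topology e \<Omega>"
  have Z: "zero_poly (tuple_divisor e a) = (\<Prod>k<e. [:- a k, 1:])"
    and P: "pole_poly (tuple_divisor e a) = (\<Prod>k<e. [:1, - cnj (a k):])" for a
    by (simp_all add: zero_poly_def pole_poly_def tuple_divisor_image multiset.map_comp o_def prod_unfold_prod_mset)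
  show z: "continuous_map ?X euclidean (\<lambda>a. coeff (zero_poly (tuple_divisor e a)) i)" for i
    unfolding Z by (intro continuous_map_coeff_prod continuous_map_coeff_linear continuous_map_minus continuous_map_coordinate) auto
  show p: "continuous_map ?X euclidean (\<lambda>a. coeff (pole_poly (tuple_divisor e a)) i)" for i
    unfolding P by (intro continuous_map_coeff_prod continuous_map_coeff_linear continuous_map_minus continuous_map_cnj continuous_map_coordinate) auto
  have d: "continuous_map ?X euclidean (\<lambda>a. coeff (pderiv (q a)) i)"
    if "\<And>i. continuous_map ?X euclidean (\<lambda>a. coeff (q a) i)" for q :: "_ \<Rightarrow> complex poly" and i
    unfolding coeff_pderiv by (intro continuous_map_mult_complex that) auto
  have c: "continuous_map ?X euclidean (\<lambda>a. coeff [:0, 1::complex:] i)" for i by simp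
  show "continuous_map ?X euclidean (\<lambda>a. coeff (crit_poly m (tuple_divisor e a)) i)" for i
    unfolding crit_poly_def coeff_add coeff_smult
    by (intro continuous_map_add continuous_map_coeff_mult continuous_map_mult_complex z p c)
       (auto intro!: continuous_map_diff continuous_map_coeff_mult z p d)
qed

lemma compact_space_power_topology: "compact \<Omega> \<Longrightarrow> compact_space (power_topology e \<Omega>)"
  unfolding power_topology_def compact_space_product_topology by (simp add: compact_space_subtopology)

text \<open>Proportionality is stated by cross products of coefficients, to make it a closed condition.\<close>

lemma Psi_ext_relation:
  assumes m: "m \<ge> 1" and D: "D \<in> Div e (cball 0 1)" and C: "C \<in> Div e (cball 0 1)"
  shows "(\<forall>i j. coeff (crit_poly m D) i * coeff (zero_poly C * pole_poly C) j =
            coeff (crit_poly m D) j * coeff (zero_poly C * pole_poly C) i) \<longleftrightarrow> C = Psi_ext m D"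
    (is "?L \<longleftrightarrow> _")
proof -
  obtain c where c: "Psi_ext m D \<in> Div e (cball 0 1)" "c \<noteq> 0"
    "crit_poly m D = smult c (zero_poly (Psi_ext m D) * pole_poly (Psi_ext m D))"
    using Psi_ext_properties[OF m D] by metis
  define G G' where "G = zero_poly C * pole_poly C" and "G' = zero_poly (Psi_ext m D) * pole_poly (Psi_ext m D)"
  have G0: "G \<noteq> 0" "G' \<noteq> 0" by (simp_all add: G_def G'_def)
  show ?thesis
  proof
    assume "C = Psi_ext m D"
    then show ?L unfolding c(3) by simp
  next
    assume L: ?L
    have L': "coeff G' i * coeff G j = coeff G' j * coeff G i" for i j
      using L[rule_format, of i j] c(2) unfolding c(3) G_def[symmetric] G'_def[symmetric] by simp
    \<comment> \<open>One nonzero coefficient of \<open>G'\<close> suffices to fix the factor of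
      proportionality.\<close>
    obtain j where j: "coeff G' j \<noteq> 0" using G0(2) leading_coeff_0_iff by blast
    define b where "b = coeff G j / coeff G' j"
    have "G = smult b G'"
      using L'[of _ j] j by (intro poly_eqI) (simp add: b_def field_simps)
    moreover from this have "b \<noteq> 0" using G0(1) by auto
    ultimately show "C = Psi_ext m D"
      using C c(1) unfolding G_def G'_def by (intro proportional_imp_eq) (auto simp: Div_def)
  qed
qed

text \<open>Closed graph argument on tuples: \<open>R\<close> is the graph pulled back to pairs of
  tuples, closed because it is given by coefficient equations. The preimage of a closed set is a
  projection of a closed set along a compact factor, hence closed; the result descends to the
  quotient.\<close>

lemma continuous_map_Psi_ext:
  assumes m: "m \<ge> 1"
  shows "continuous_map (Div_topology e (cball 0 1)) (Div_topology e (cball 0 1)) (Psi_ext m)"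
proof -
  let ?X = "power_topology e (cball (0::complex) 1)" and ?T = "Div_topology e (cball 0 1)" and ?q = "tuple_divisor e"
  have qX: "?q a \<in> Div e (cball 0 1)" if "a \<in> topspace ?X" for a
    using that tuple_divisor_image_PiE[of e "cball 0 1"] by (auto simp: topspace_power_topology)
  have qc: "continuous_map ?X ?T ?q" by (rule quotient_imp_continuous_map[OF quotient_map_tuple_divisor])
  let ?F = "\<lambda>a i. coeff (crit_poly m (?q a)) i" and ?G = "\<lambda>c i. coeff (zero_poly (?q c) * pole_poly (?q c)) i"
  define R where "R = {x \<in> topspace (prod_topology ?X ?X). \<forall>i j. ?F (fst x) i * ?G (snd x) j = ?F (fst x) j * ?G (snd x) i}"
  have R_iff: "(a, c) \<in> R \<longleftrightarrow> ?q c = Psi_ext m (?q a)" if "a \<in> topspace ?X" "c \<in> topspace ?X" for a c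
    using that Psi_ext_relation[OF m qX[OF that(1)] qX[OF that(2)]] by (simp add: R_def)
  have R_closed: "closedin (prod_topology ?X ?X) R"
  proof -
    have F: "continuous_map (prod_topology ?X ?X) euclidean (\<lambda>x. ?F (fst x) i)" for i
      using continuous_map_compose[OF continuous_map_fst continuous_map_coeff_crit_poly] by (simp add: o_def)
    have G: "continuous_map (prod_topology ?X ?X) euclidean (\<lambda>x. ?G (snd x) i)" for i
      using continuous_map_compose[OF continuous_map_snd continuous_map_coeff_mult[OF continuous_map_coeff_zero_poly continuous_map_coeff_pole_poly]]
      by (simp add: o_def)
    have "closedin (prod_topology ?X ?X) {x \<in> topspace (prod_topology ?X ?X). ?F (fst x) i * ?G (snd x) j = ?F (fst x) j * ?G (snd x) i}" for i j
      by (rule closedin_continuous_maps_eq[OF Hausdorff_space_euclidean]) (intro continuous_map_mult_complex F G)+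
    moreover have "R = (\<Inter>i. \<Inter>j. {x \<in> topspace (prod_topology ?X ?X). ?F (fst x) i * ?G (snd x) j = ?F (fst x) j * ?G (snd x) i})"
      by (auto simp: R_def)
    ultimately show ?thesis by (metis (no_types, lifting) closedin_INT UNIV_not_empty)
  qed
  have "continuous_map ?X ?T (Psi_ext m \<circ> ?q)"
    unfolding continuous_map_closedin
  proof (intro conjI allI impI)
    show "Psi_ext m \<circ> ?q \<in> topspace ?X \<rightarrow> topspace ?T"
      using Psi_ext_in_Div[OF m qX] by (simp add: topspace_Div_topology Pi_iff)
    fix K assume K: "closedin ?T K"
    have eq: "{a \<in> topspace ?X. (Psi_ext m \<circ> ?q) a \<in> K} = fst ` (R \<inter> {x \<in> topspace (prod_topology ?X ?X). ?q (snd x) \<in> K})"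
    proof (intro equalityI subsetI)
      fix a assume a: "a \<in> {a \<in> topspace ?X. (Psi_ext m \<circ> ?q) a \<in> K}"
      then have "Psi_ext m (?q a) \<in> Div e (cball 0 1)" using Psi_ext_in_Div[OF m qX] by blast
      then obtain c where c: "c \<in> topspace ?X" "?q c = Psi_ext m (?q a)"
        unfolding topspace_power_topology by (rule Div_tupleE)
      then have "(a, c) \<in> R \<inter> {x \<in> topspace (prod_topology ?X ?X). ?q (snd x) \<in> K}"
        using a R_iff by auto
      then show "a \<in> fst ` (R \<inter> {x \<in> topspace (prod_topology ?X ?X). ?q (snd x) \<in> K})" by force
    next
      fix a assume "a \<in> fst ` (R \<inter> {x \<in> topspace (prod_topology ?X ?X). ?q (snd x) \<in> K})"
      then obtain c where c: "(a, c) \<in> R" "a \<in> topspace ?X" "c \<in> topspace ?X" "?q c \<in> K" by auto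
      then show "a \<in> {a \<in> topspace ?X. (Psi_ext m \<circ> ?q) a \<in> K}" using R_iff by simp
    qed
    have "closedin (prod_topology ?X ?X) {x \<in> topspace (prod_topology ?X ?X). ?q (snd x) \<in> K}"
      using closedin_continuous_map_preimage[OF continuous_map_compose[OF continuous_map_snd qc] K] by (simp add: o_def)
    moreover have "closed_map (prod_topology ?X ?X) ?X fst"
      by (rule Abstract_Topological_Spaces.closed_map_fst[OF compact_space_power_topology[OF compact_cball]])
    ultimately show "closedin ?X {a \<in> topspace ?X. (Psi_ext m \<circ> ?q) a \<in> K}"
      unfolding eq closed_map_def using R_closed closedin_Int by blast
  qed
  then show ?thesis using continuous_compose_quotient_map[OF quotient_map_tuple_divisor] by blast
qed

section \<open>Surjectivity\<close>

text \<open>The \<open>e\<close> coefficients below the leading 1, as \<open>2 * e\<close> real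
  coordinates; the padding by 0 places them in \<open>Euclidean_space (2 * e)\<close>, where
  invariance of domain is applied.\<close>

definition Div_coords :: "nat \<Rightarrow> complex multiset \<Rightarrow> nat \<Rightarrow> real" where
  "Div_coords e D = (\<lambda>i. if i < 2 * e then
     (if even i then Re (coeff (zero_poly D) (i div 2)) else Im (coeff (zero_poly D) (i div 2))) else 0)"

lemma zero_poly_monic: "degree (zero_poly D) = size D" "coeff (zero_poly D) (size D) = 1"
proof -
  have "degree (zero_poly D) = size D \<and> lead_coeff (zero_poly D) = 1"
  proof (induction D)
    case (add x D)
    then have IH: "degree (zero_poly D) = size D" "coeff (zero_poly D) (size D) = 1" by auto
    have "degree (zero_poly (add_mset x D)) = Suc (size D)"
      unfolding zero_poly_add_mset using IH by (subst degree_mult_eq) auto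
    moreover have "coeff (zero_poly (add_mset x D)) (Suc (size D)) = 1"
      using IH coeff_eq_0[of "zero_poly D" "Suc (size D)"] by (simp add: zero_poly_add_mset)
    ultimately show ?case by simp
  qed simp
  then show "degree (zero_poly D) = size D" "coeff (zero_poly D) (size D) = 1" by auto
qed

lemma coeff_zero_poly_coords:
  assumes "size D = e"
  shows "coeff (zero_poly D) i =
    (if i < e then Complex (Div_coords e D (2 * i)) (Div_coords e D (2 * i + 1)) else if i = e then 1 else 0)"
  using assms zero_poly_monic[of D] coeff_eq_0[of "zero_poly D" i] by (auto simp: Div_coords_def complex_eq_iff)

lemma Div_coords_inj: "inj_on (Div_coords e) (Div e \<Omega>)"
proof (rule inj_onI)
  fix D D' assume "D \<in> Div e \<Omega>" "D' \<in> Div e \<Omega>" "Div_coords e D = Div_coords e D'"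
  then have "zero_poly D = zero_poly D'"
    by (intro poly_eqI) (simp add: coeff_zero_poly_coords[of _ e] Div_def)
  then show "D = D'" by (rule zero_poly_inj)
qed

lemma continuous_map_Div_coords:
  "continuous_map (Div_topology e \<Omega>) (Euclidean_space (2 * e)) (Div_coords e)"
proof (rule continuous_compose_quotient_map[OF quotient_map_tuple_divisor])
  have "continuous_map (power_topology e \<Omega>) euclidean (Re \<circ> (\<lambda>a. coeff (zero_poly (tuple_divisor e a)) j))"
    "continuous_map (power_topology e \<Omega>) euclidean (Im \<circ> (\<lambda>a. coeff (zero_poly (tuple_divisor e a)) j))" for j
    by (rule continuous_map_compose[OF continuous_map_coeff_zero_poly], simp add: continuous_on_Re continuous_on_Im)+
  then show "continuous_map (power_topology e \<Omega>) (Euclidean_space (2 * e)) (Div_coords e \<circ> tuple_divisor e)"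
    unfolding Div_coords_def o_def continuous_map_componentwise_Euclidean_space by auto
qed

text \<open>For \<open>norm z \<ge> 1\<close>, \<open>norm (z - x) \<ge> norm z - norm x \<ge> (1 -
  norm x) * norm z\<close>. The bound grows like the leading term, so it can absorb perturbations of
  the lower coefficients on the whole exterior of the disk.\<close>

lemma norm_zero_poly_ge:
  assumes "set_mset D \<subseteq> ball 0 1" "norm z \<ge> 1"
  shows "norm (poly (zero_poly D) z) \<ge> (\<Prod>x\<in>#D. 1 - norm x) * norm z ^ size D"
  using assms(1)
proof (induction D)
  case (add x D)
  have x: "norm x < 1" using add.prems by simp
  have "norm z - norm x \<ge> norm z - norm x * norm z" using mult_left_mono[OF assms(2), of "norm x"] by simp
  then have "(1 - norm x) * norm z \<le> norm (z - x)" using norm_triangle_ineq2[of z x] by (simp add: algebra_simps)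
  moreover have "(\<Prod>x\<in>#D. 1 - norm x) \<ge> 0" using add.prems by (induction D) (auto simp: less_imp_le)
  ultimately have "((1 - norm x) * norm z) * ((\<Prod>x\<in>#D. 1 - norm x) * norm z ^ size D) \<le> norm (z - x) * norm (poly (zero_poly D) z)"
    using add x by (intro mult_mono) auto
  then show ?case by (simp add: poly_zero_poly norm_mult mult_ac)
qed simp

text \<open>Roots stay in the open disk under small changes of coefficients: at a root
  \<open>w\<close> outside, the perturbation would have to cancel \<open>zero_poly D\<close>, but it
  is smaller than the bound of \<open>norm_zero_poly_ge\<close>.\<close>

lemma openin_Div_coords_ball:
  "openin (Euclidean_space (2 * e)) (Div_coords e ` Div e (ball 0 1))" (is "openin ?E (?c ` ?U)")
proof (rule openin_subopen[THEN iffD2], rule ballI)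
  fix x assume "x \<in> ?c ` ?U"
  then obtain D where D: "D \<in> ?U" "x = ?c D" by blast
  then have D': "set_mset D \<subseteq> ball 0 1" "size D = e" by (auto simp: Div_def)
  define \<delta> where "\<delta> = (\<Prod>x\<in>#D. 1 - norm x)"
  have \<delta>: "\<delta> > 0" unfolding \<delta>_def using D'(1) by (induction D) auto
  \<comment> \<open>Each of the \<open>e\<close> lower coefficients moves by at most
    \<open>2 * \<epsilon>\<close>, counting real and imaginary part. The summand 1 makes the total
    strictly less than \<open>\<delta>\<close> and covers \<open>e = 0\<close>.\<close>
  define \<epsilon> where "\<epsilon> = \<delta> / (2 * e + 1)"
  have \<epsilon>: "\<epsilon> > 0" "2 * \<epsilon> * e < \<delta>" using \<delta> by (auto simp: \<epsilon>_def field_simps)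
  define V where "V = (\<Inter>i<2 * e. {y \<in> topspace ?E. y i \<in> ball (x i) \<epsilon>}) \<inter> topspace ?E"
  have "continuous_map ?E euclideanreal (\<lambda>y. y i)" for i
    unfolding Euclidean_space_def by (intro continuous_map_from_subtopology continuous_map_product_projection) auto
  then have "openin ?E {y \<in> topspace ?E. y i \<in> ball (x i) \<epsilon>}" for i
    by (rule openin_continuous_map_preimage) simp
  then have "openin ?E V"
    unfolding V_def by (intro openin_INT) auto
  moreover have "x \<in> V" using \<epsilon> by (auto simp: V_def D(2) topspace_Euclidean_space Div_coords_def)
  moreover have "V \<subseteq> ?c ` ?U"
  proof
    fix y assume y: "y \<in> V"
    then have y0: "\<And>i. i \<ge> 2 * e \<Longrightarrow> y i = 0" and close: "\<And>i. i < 2 * e \<Longrightarrow> \<bar>y i - x i\<bar> < \<epsilon>"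
      by (auto simp: V_def topspace_Euclidean_space dist_real_def abs_minus_commute)
    \<comment> \<open>The monic polynomial with coordinates \<open>y\<close>; its roots form the
      only candidate divisor, and it remains to place them in the disk.\<close>
    define p where "p = (\<Sum>i<e. monom (Complex (y (2 * i)) (y (2 * i + 1))) i) + monom 1 e"
    have pc: "coeff p i = (if i < e then Complex (y (2 * i)) (y (2 * i + 1)) else if i = e then 1 else 0)" for i
      by (simp add: p_def coeff_sum coeff_monom)
    have deg: "degree p = e"
      by (intro antisym degree_le le_degree) (auto simp: pc)
    have "p \<noteq> 0" using pc[of e] by auto
    then obtain A where A: "size A = e" "p = zero_poly A"
      using alg_closed_imp_factorization[of p] deg pc[of e] by (auto simp: zero_poly_def)
    have cA: "?c A = y"
    proof
      fix i
      show "?c A i = y i"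
      proof (cases "i < 2 * e")
        case True
        then have "coeff p (i div 2) = Complex (y (2 * (i div 2))) (y (2 * (i div 2) + 1))" by (simp add: pc)
        then show ?thesis using True A(2) by (cases "even i") (auto simp: Div_coords_def elim!: evenE oddE)
      qed (simp add: Div_coords_def y0)
    qed
    have "set_mset A \<subseteq> ball 0 1"
    proof (rule ccontr)
      assume "\<not> ?thesis"
      then obtain w where w: "w \<in># A" "norm w \<ge> 1" by (auto simp: subset_iff not_less)
      have "poly p w = 0" using w(1) by (auto simp: A(2) poly_zero_poly prod_mset_zero_iff)
      moreover have "degree (p - zero_poly D) \<le> e" using deg zero_poly_monic(1)[of D] D'(2) by (intro degree_diff_le) auto
      then have "poly (p - zero_poly D) w = (\<Sum>i\<le>e. coeff (p - zero_poly D) i * w ^ i)"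
        unfolding poly_altdef using coeff_eq_0[of "p - zero_poly D"] by (intro sum.mono_neutral_left) (auto simp: not_le)
      \<comment> \<open>Both polynomials are monic of degree \<open>e\<close>, so the top term of
        the difference cancels.\<close>
      moreover have "\<dots> = (\<Sum>i<e. coeff (p - zero_poly D) i * w ^ i)"
        using zero_poly_monic(2)[of D] D'(2) pc[of e] by (simp add: lessThan_Suc_atMost[symmetric])
      ultimately have "norm (poly (zero_poly D) w) = norm (\<Sum>i<e. coeff (p - zero_poly D) i * w ^ i)"
        by (metis diff_0 norm_minus_cancel poly_diff)
      also have "\<dots> \<le> (\<Sum>i<e. 2 * \<epsilon> * norm w ^ e)"
      proof (rule sum_norm_le)
        fix i assume i: "i \<in> {..<e}"
        have "coeff (p - zero_poly D) i = Complex (y (2 * i) - x (2 * i)) (y (2 * i + 1) - x (2 * i + 1))"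
          using i pc[of i] coeff_zero_poly_coords[OF D'(2), of i] D(2) by (simp add: complex_diff)
        then have "norm (coeff (p - zero_poly D) i) \<le> \<bar>y (2 * i) - x (2 * i)\<bar> + \<bar>y (2 * i + 1) - x (2 * i + 1)\<bar>"
          using cmod_le by (metis complex.sel)
        also have "\<dots> \<le> 2 * \<epsilon>" using close[of "2 * i"] close[of "2 * i + 1"] i by simp
        finally show "norm (coeff (p - zero_poly D) i * w ^ i) \<le> 2 * \<epsilon> * norm w ^ e"
          unfolding norm_mult norm_power using w(2) i \<epsilon>(1) by (intro mult_mono power_increasing) auto
      qed
      also have "\<dots> = (2 * \<epsilon> * e) * norm w ^ e" by simp
      also have "\<dots> < \<delta> * norm w ^ e" using \<epsilon>(2) w(2) by (intro mult_strict_right_mono zero_less_power) auto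
      also have "\<dots> \<le> norm (poly (zero_poly D) w)"
        using norm_zero_poly_ge[OF D'(1) w(2)] D'(2) by (simp add: \<delta>_def)
      finally show False by simp
    qed
    then show "y \<in> ?c ` ?U" using cA A(1) by (auto simp: Div_def)
  qed
  ultimately show "\<exists>V. openin ?E V \<and> x \<in> V \<and> V \<subseteq> ?c ` ?U" by blast
qed

section \<open>Topology of the divisor space\<close>

lemma compact_space_Div_topology:
  assumes "compact \<Omega>" shows "compact_space (Div_topology e \<Omega>)"
  using image_compactin[OF _ quotient_imp_continuous_map[OF quotient_map_tuple_divisor]]
    compact_space_power_topology[OF assms, of e]
  unfolding compact_space_def by (metis quotient_imp_surjective_map quotient_map_tuple_divisor)

text \<open>Polynomial coefficients are continuous on the quotient and separate divisors.\<close>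

lemma Hausdorff_space_Div_topology: "Hausdorff_space (Div_topology e \<Omega>)"
  by (rule Hausdorff_space_injective_preimage[OF Hausdorff_Euclidean_space continuous_map_Div_coords])
     (simp add: topspace_Div_topology Div_coords_inj)

lemma Div_ball_subset: "Div e (ball 0 1) \<subseteq> Div e (cball 0 1)"
  using ball_subset_cball unfolding Div_def by blast

lemma connectedin_Div_ball: "connectedin (Div_topology e (cball 0 1)) (Div e (ball 0 1))"
proof -
  have "connectedin (power_topology e (cball 0 1)) ({..<e} \<rightarrow>\<^sub>E ball (0::complex) 1)"
    unfolding power_topology_def connectedin_PiE
    by (intro disjI2 ballI) (simp add: connectedin_subtopology ball_subset_cball)
  from connectedin_continuous_map_image[OF quotient_imp_continuous_map[OF quotient_map_tuple_divisor] this]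
  show ?thesis by (simp add: tuple_divisor_image_PiE)
qed

lemma Psi_ext_surj_ball:
  assumes m: "m \<ge> 1"
  shows "Psi_ext m ` Div e (ball 0 1) = Div e (ball 0 1)"
proof -
  let ?T = "Div_topology e (cball 0 1)" and ?U = "Div e (ball 0 1)" and ?E = "Euclidean_space (2 * e)" and ?c = "Div_coords e"
  have UT: "?U \<subseteq> topspace ?T" using Div_ball_subset by (simp add: topspace_Div_topology)
  have inj: "inj_on ?c (topspace ?T)" by (simp add: topspace_Div_topology Div_coords_inj)
  have sub: "Psi_ext m ` ?U \<subseteq> ?U"
    using Psi_properties[OF m] Psi_ext_ball by (metis image_subsetI)
  \<comment> \<open>Compactness of the closed divisor space makes the injective coordinate map an
    embedding, with continuous inverse \<open>h\<close> on its image.\<close>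
  have "embedding_map ?T ?E ?c"
    using continuous_map_Div_coords compact_space_Div_topology[OF compact_cball] Hausdorff_Euclidean_space inj
    by (rule continuous_imp_embedding_map)
  then obtain h where "homeomorphic_maps ?T (subtopology ?E (?c ` topspace ?T)) ?c h"
    unfolding embedding_map_def homeomorphic_map_maps by blast
  then have h: "continuous_map (subtopology ?E (?c ` topspace ?T)) ?T h" "\<And>D. D \<in> topspace ?T \<Longrightarrow> h (?c D) = D"
    by (auto simp: homeomorphic_maps_def)
  \<comment> \<open>The extended map written in coordinates, to which invariance of domain
    applies.\<close>
  let ?g = "?c \<circ> Psi_ext m \<circ> h"
  have gU: "?g (?c D) = ?c (Psi_ext m D)" if "D \<in> ?U" for D using h(2) UT that by auto
  have "openin ?E (?g ` ?c ` ?U)"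
  proof (rule invariance_of_domain_Euclidean_space[OF openin_Div_coords_ball])
    have "continuous_map (subtopology ?E (?c ` topspace ?T)) ?E ?g"
      using continuous_map_compose[OF continuous_map_compose[OF h(1) continuous_map_Psi_ext[OF m]] continuous_map_Div_coords]
      by (simp add: comp_assoc)
    then show "continuous_map (subtopology ?E (?c ` ?U)) ?E ?g"
      using continuous_map_from_subtopology_mono UT by (metis image_mono)
    have "inj_on (Psi_ext m) ?U" using Psi_ext_inj[OF m] Div_ball_subset inj_on_subset by blast
    then have "inj_on (?c \<circ> Psi_ext m) ?U"
      using inj UT sub by (intro comp_inj_on) (auto intro: inj_on_subset)
    then show "inj_on ?g (?c ` ?U)" using gU by (auto simp: inj_on_def)
  qed
  moreover have "?g ` ?c ` ?U = ?c ` Psi_ext m ` ?U"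
    unfolding image_image using gU by (rule image_cong[OF refl])
  ultimately have "openin ?E (?c ` Psi_ext m ` ?U)" by (simp only:)
  then have "openin ?T {D \<in> topspace ?T. ?c D \<in> ?c ` Psi_ext m ` ?U}"
    by (rule openin_continuous_map_preimage[OF continuous_map_Div_coords])
  moreover have "{D \<in> topspace ?T. ?c D \<in> ?c ` Psi_ext m ` ?U} = Psi_ext m ` ?U"
    using sub UT inj_on_image_mem_iff[OF inj, of _ "Psi_ext m ` ?U"] by blast
  ultimately have "openin ?T (Psi_ext m ` ?U)" by simp
  then have op: "openin (subtopology ?T ?U) (Psi_ext m ` ?U)"
    using sub by (metis inf.absorb_iff2 openin_subtopology_Int2)
  have "closedin ?T (Psi_ext m ` topspace ?T)"
    using compactin_imp_closedin[OF Hausdorff_space_Div_topology image_compactin[OF _ continuous_map_Psi_ext[OF m]]]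
      compact_space_Div_topology[OF compact_cball] by (simp add: compact_space_def)
  \<comment> \<open>Boundary divisors keep their circle points, so only interior ones are mapped
    into the interior. Hence the image of the interior is relatively closed.\<close>
  moreover have "?U \<inter> Psi_ext m ` topspace ?T = Psi_ext m ` ?U"
  proof (intro equalityI subsetI)
    fix C assume C: "C \<in> ?U \<inter> Psi_ext m ` topspace ?T"
    then obtain D where D: "D \<in> Div e (cball 0 1)" "C = Psi_ext m D" by (auto simp: topspace_Div_topology)
    obtain d1 d2 D1 D2 where *: "D = D1 + D2" "d1 + d2 = e" "D1 \<in> Div d1 (ball 0 1)" "D2 \<in> Div d2 (sphere 0 1)"
      using D(1) by (rule Div_cballE)
    have "C = Psi d1 m D1 + D2" using D(2) * Psi_ext_union by simp
    then have "set_mset D2 \<subseteq> ball 0 1" using C by (auto simp: Div_def)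
    then have "D2 = {#}" using *(4) by (fastforce simp: Div_def subset_iff intro: multiset_nonemptyE)
    then have "D \<in> ?U" using * by (simp add: Div_def)
    then show "C \<in> Psi_ext m ` ?U" using D(2) by blast
  qed (use sub UT in blast)
  ultimately have "closedin (subtopology ?T ?U) (Psi_ext m ` ?U)"
    by (metis closedin_subtopology_Int_closed)
  moreover have "connected_space (subtopology ?T ?U)" using connectedin_Div_ball by (simp add: connectedin_def)
  ultimately have "Psi_ext m ` ?U = {} \<or> Psi_ext m ` ?U = topspace (subtopology ?T ?U)"
    using op unfolding connected_space_clopen_in by blast
  moreover have "replicate_mset e 0 \<in> ?U" by (auto simp: Div_def)
  ultimately show ?thesis using UT by (auto simp: topspace_subtopology_subset)
qed

text \<open>Surjectivity on the open disk is used in the degree \<open>d1\<close> of the inner part;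
  the circle part is carried along.\<close>

lemma Psi_ext_surj:
  assumes m: "m \<ge> 1"
  shows "Psi_ext m ` Div e (cball 0 1) = Div e (cball 0 1)"
proof (intro equalityI subsetI)
  fix D assume "D \<in> Psi_ext m ` Div e (cball 0 1)"
  then show "D \<in> Div e (cball 0 1)" using Psi_ext_in_Div[OF m] by blast
next
  fix D assume "D \<in> Div e (cball 0 1)"
  then obtain d1 d2 D1 D2 where *: "D = D1 + D2" "d1 + d2 = e" "D1 \<in> Div d1 (ball 0 1)" "D2 \<in> Div d2 (sphere 0 1)"
    by (rule Div_cballE)
  then obtain C where C: "C \<in> Div d1 (ball 0 1)" "Psi_ext m C = D1" using Psi_ext_surj_ball[OF m, of d1] by force
  then have "Psi_ext m (C + D2) = D" using Psi_ext_union[OF C(1) *(4)] Psi_ext_ball[OF C(1)] *(1) by simp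
  then show "D \<in> Psi_ext m ` Div e (cball 0 1)" using Div_union[OF C(1) *(4)] *(2) by blast
qed

theorem theorem2p2:
  fixes e m :: nat
  assumes "e \<ge> 1" and "m \<ge> 1"
  shows "\<exists>\<Phi> :: complex multiset \<Rightarrow> complex multiset.
    homeomorphic_map (Div_topology e (cball 0 1)) (Div_topology e (cball 0 1)) \<Phi> \<and>
    (\<forall>D \<in> Div e (ball 0 1). \<Phi> D = Psi e m D) \<and>
    (\<forall>D \<in> Div_topology e (cball 0 1) frontier_of Div e (ball 0 1).
       \<forall>d1 d2 D1 D2. D = D1 + D2 \<and> d1 + d2 = e \<and>
         D1 \<in> Div d1 (ball 0 1) \<and> D2 \<in> Div d2 (sphere 0 1) \<longrightarrow>
         \<Phi> D = Psi d1 m D1 + D2)"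
proof (intro exI[of _ "Psi_ext m"] conjI)
  show "homeomorphic_map (Div_topology e (cball 0 1)) (Div_topology e (cball 0 1)) (Psi_ext m)"
    using continuous_map_Psi_ext[OF assms(2)] compact_space_Div_topology[OF compact_cball] Hausdorff_space_Div_topology
    by (rule continuous_imp_homeomorphic_map)
       (simp_all add: topspace_Div_topology Psi_ext_surj[OF assms(2)] Psi_ext_inj[OF assms(2)])
qed (use Psi_ext_ball Psi_ext_union in auto)

end
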